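(* Let $n_A,n_B,n_C$ be positive integers, $n=n_A+n_B+n_C$, $d=2^n$, $d_A=2^{n_A}$, $d_B=2^{n_B}$. Let $|\Psi\rangle_{ABC}$ be a Haar random pure state on the $n$-qubit system $ABC$ and $\rho_{AB}=\operatorname{Tr}_C|\Psi\rangle\langle\Psi|$. Let $m\in\mathbb{N}$ and $0<h\le1$, and suppose $\delta:=h^2-2^{-m}>0$. Then for every constant $0<c<1$, $$\log\Pr\Big[E_{D,h}^{[\mathrm{LO}]}(A:B)\ge m\Big]\le -c\,\delta^2 d+O\Big(2^{2m}(d_A^2+d_B^2)\log\tfrac1\delta\Big).$$
   Context: $A,B,C$ are systems of $n_A,n_B,n_C$ qubits. $|\mathrm{EPR}\rangle=\frac{1}{\sqrt2}(|00\rangle+|11\rangle)$. For $m$-qubit systems $R_A,R_B$, $\Pi^{[\mathrm{EPR}]}_{R_AR_B}$ is the projector onto $m$ EPR pairs, each pairing one qubit of $R_A$ with one of $R_B$. The one-shot LO-distillable entanglement is $E_{D,h}^{[\mathrm{LO}]}(A:B)=\sup\{m\in\mathbb{N}:\exists\,\Lambda=\Phi_A\otimes\Phi_B,\ \operatorname{Tr}(\Lambda(\rho_{AB})\Pi^{[\mathrm{EPR}]}_{R_AR_B})\ge h^2\}$, where $\Phi_A$ is any quantum channel (CPTP map) from states on $A$ to states on an $m$-qubit system $R_A$, and similarly $\Phi_B$ from $B$ to an $m$-qubit system $R_B$. Haar random means uniformly distributed on unit vectors of $\mathbb{C}^d$. $\log$ is the logarithm and the $O(\cdot)$ term hides a multiplicative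 constant depending only on $c$. *)

theory Defs
  imports "HOL-Analysis.Analysis" "HOL-Library.Extended_Nat"
begin

text \<open>Finite-dimensional complex matrices are represented as functions
  nat => nat => complex, with the dimension carried separately; only the
  entries with indices below the dimension are meaningful.  Vectors are
  nat => complex.  Composite systems XY with dimensions dX, dY use the
  index x * dY + y.\<close>

type_synonym cmat = "nat \<Rightarrow> nat \<Rightarrow> complex"

definition mtrace :: "nat \<Rightarrow> cmat \<Rightarrow> complex" where
  "mtrace n X = (\<Sum>i<n. X i i)"

definition psd :: "nat \<Rightarrow> cmat \<Rightarrow> bool" where
  "psd n X \<longleftrightarrow> (\<forall>v::nat \<Rightarrow> complex.
     Im (\<Sum>i<n. \<Sum>j<n. cnj (v i) * X i j * v j) = 0 \<and>
     0 \<le> Re (\<Sum>i<n. \<Sum>j<n. cnj (v i) * X i j * v j))"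

text \<open>(Phi tensor id_k)(X), for X acting on C^p tensor C^k (index a*k+s).\<close>
definition ampl :: "nat \<Rightarrow> (cmat \<Rightarrow> cmat) \<Rightarrow> cmat \<Rightarrow> cmat" where
  "ampl k Phi X = (\<lambda>u w. Phi (\<lambda>a b. X (a * k + u mod k) (b * k + w mod k)) (u div k) (w div k))"

definition channel :: "nat \<Rightarrow> nat \<Rightarrow> (cmat \<Rightarrow> cmat) \<Rightarrow> bool" where
  "channel p q Phi \<longleftrightarrow>
     (\<forall>X Y. (\<forall>i<p. \<forall>j<p. X i j = Y i j) \<longrightarrow> (\<forall>i<q. \<forall>j<q. Phi X i j = Phi Y i j)) \<and>
     (\<forall>(a::complex) X Y. \<forall>i<q. \<forall>j<q.
        Phi (\<lambda>r s. a * X r s + Y r s) i j = a * Phi X i j + Phi Y i j) \<and>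
     (\<forall>X. mtrace q (Phi X) = mtrace p X) \<and>
     (\<forall>k\<ge>1. \<forall>X. psd (p * k) X \<longrightarrow> psd (q * k) (ampl k Phi X))"

definition unitm :: "nat \<Rightarrow> nat \<Rightarrow> cmat" where
  "unitm a b = (\<lambda>i j. if i = a \<and> j = b then 1 else 0)"

text \<open>(PhiA tensor PhiB)(rho) for rho on C^dA tensor C^dB, output on C^qA tensor C^qB.\<close>
definition lo_apply :: "nat \<Rightarrow> nat \<Rightarrow> nat \<Rightarrow> (cmat \<Rightarrow> cmat) \<Rightarrow> (cmat \<Rightarrow> cmat) \<Rightarrow> cmat \<Rightarrow> cmat" where
  "lo_apply dA dB qB PhiA PhiB rho = (\<lambda>u w.
     \<Sum>a<dA. \<Sum>a'<dA. \<Sum>b<dB. \<Sum>b'<dB.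
       rho (a * dB + b) (a' * dB + b') * PhiA (unitm a a') (u div qB) (w div qB)
         * PhiB (unitm b b') (u mod qB) (w mod qB))"

text \<open>Tr(sg Pi^EPR) for sg on R_A R_B (m qubits each, M = 2^m), where the
  k-th qubit of R_A is paired with the k-th qubit of R_B, i.e.
  |EPR>^m = M^(-1/2) sum_r |r>|r>.\<close>
definition epr_overlap :: "nat \<Rightarrow> cmat \<Rightarrow> complex" where
  "epr_overlap m sg = (\<Sum>r<2^m. \<Sum>r'<(2::nat)^m.
      sg (r * 2^m + r) (r' * 2^m + r')) / of_nat (2^m)"

definition lo_achievable :: "nat \<Rightarrow> nat \<Rightarrow> cmat \<Rightarrow> real \<Rightarrow> nat \<Rightarrow> bool" where
  "lo_achievable dA dB rho h m \<longleftrightarrow>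
     (\<exists>PhiA PhiB. channel dA (2^m) PhiA \<and> channel dB (2^m) PhiB \<and>
        h^2 \<le> Re (epr_overlap m (lo_apply dA dB (2^m) PhiA PhiB rho)))"

definition ED_LO :: "nat \<Rightarrow> nat \<Rightarrow> cmat \<Rightarrow> real \<Rightarrow> enat" where
  "ED_LO dA dB rho h = Sup (enat ` {m. lo_achievable dA dB rho h m})"

text \<open>rho_AB = Tr_C |psi><psi|, psi on ABC with index (a*dB+b)*dC + c.\<close>
definition rhoAB :: "nat \<Rightarrow> (nat \<Rightarrow> complex) \<Rightarrow> cmat" where
  "rhoAB dC psi = (\<lambda>i j. \<Sum>c<dC. psi (i * dC + c) * cnj (psi (j * dC + c)))"

text \<open>Haar (uniform) measure on the unit sphere of C^d, realised as the cone
  measure: the probability of an event P is the normalised Lebesgue measure of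
  the set of nonzero vectors in the unit ball whose normalisation satisfies P.\<close>
definition cvec_space :: "nat \<Rightarrow> (nat \<Rightarrow> complex) measure" where
  "cvec_space d = PiM {..<d} (\<lambda>_. lborel)"

definition vnorm :: "nat \<Rightarrow> (nat \<Rightarrow> complex) \<Rightarrow> real" where
  "vnorm d v = sqrt (\<Sum>i<d. (cmod (v i))^2)"

definition haar_event :: "nat \<Rightarrow> ((nat \<Rightarrow> complex) \<Rightarrow> bool) \<Rightarrow> (nat \<Rightarrow> complex) set" where
  "haar_event d P = {v \<in> space (cvec_space d). 0 < vnorm d v \<and> vnorm d v \<le> 1 \<and>
       P (\<lambda>i. v i / complex_of_real (vnorm d v))}"

definition haar_prob :: "nat \<Rightarrow> ((nat \<Rightarrow> complex) \<Rightarrow> bool) \<Rightarrow> real" where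
  "haar_prob d P = measure (cvec_space d) (haar_event d P) /
      measure (cvec_space d) {v \<in> space (cvec_space d). vnorm d v \<le> 1}"

end

theory Submission
  imports Defs "Jordan_Normal_Form.Schur_Decomposition"
begin

text \<open>
  For fixed local channels the EPR overlap is a quadratic form \<open>W\<close> in the state vector, with
  \<open>0 \<le> W \<le> 1\<close> and trace at most \<open>d / 2^m\<close>. The part of the unit ball where its Rayleigh quotient
  is at least \<open>t\<close> lies in an ellipsoid whose volume, computed by a determinant, is smaller than that of the
  ball by a factor \<open>exp (- 2 d (t - 2^- m)^2)\<close>. This exponent is twice what is needed, which leaves
  room to replace all channels by a net of accuracy proportional to \<open>\<delta>\<close>. Such a net
  with \<open>O (1 / \<delta>)^(2 (d_A^2 + d_B^2) 2^(2 m))\<close> elements comes from comparing volumes of Choi matrices in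
  the norm dual to the overlap. Discarding EPR pairs preserves the overlap threshold, so when
  \<open>\<delta> \<ge> 1/2\<close> only four pairs are kept: this is essential, since \<open>ln (1 / \<delta>)\<close> can then be of order
  \<open>2^- m\<close>, too small to pay for a net of channels with \<open>m\<close> output qubits.
\<close>

section \<open>Determinants and traces of Hermitian forms\<close>

hide_const (open) Determinants.det Finite_Cartesian_Product.mat Finite_Cartesian_Product.row Finite_Cartesian_Product.vec

no_notation Finite_Cartesian_Product.vec_nth (infixl "$" 90)

text \<open>The cone measure turns probabilities on the sphere into ratios of Lebesgue volumes. Of
  \<open>W\<close> only the spectral interval [0,1] and the trace are used: concavity of
  \<open>ln\<close> bounds the determinant from below by these alone. The number \<open>2^-m\<close>
  bounds the mean overlap, since the trace of \<open>W\<close> is \<open>d_C / 2^m\<close> times the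
  entrywise pairing of Phi_A(1) with Phi_B(1), whose traces are \<open>d_A\<close> and
  \<open>d_B\<close>. The obstacle is the net: each real parameter may cost only a constant times
  \<open>ln (1 / \<delta>)\<close>, so no dimension may enter inside the logarithm. In the dual norm
  all channels lie in the unit ball, and volume comparison in one fixed norm gives
  \<open>(1 + 2/e)^k\<close> in real dimension \<open>k\<close>, whatever the shape of that ball.
  Budget: replacing both channels costs \<open>\<delta>/16\<close> each and leaves
  \<open>7/8 \<delta>\<close>; keeping four pairs costs at most another factor 7/8;
  \<open>2 (7/8)^4 > 1\<close> pays for both and for every \<open>c \<le> 1\<close> with one
  constant. That constant is 3584 = 14 * 16^2: 14 is twice the 7 of 128 = 2^7, and 16 is the
  dimension of four qubits. The event quantifies over uncountably many channels; compactness of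
  their Choi matrices makes it measurable.\<close>

definition qform :: "nat \<Rightarrow> cmat \<Rightarrow> (nat \<Rightarrow> complex) \<Rightarrow> complex" where
  "qform n Q v = (\<Sum>i<n. \<Sum>j<n. cnj (v i) * Q i j * v j)"

definition sqnorm :: "'i set \<Rightarrow> ('i \<Rightarrow> complex) \<Rightarrow> real" where
  "sqnorm I v = (\<Sum>i\<in>I. (cmod (v i))\<^sup>2)"

lemma psd_qform: "psd n X \<longleftrightarrow> (\<forall>v. Im (qform n X v) = 0 \<and> 0 \<le> Re (qform n X v))"
  by (simp add: psd_def qform_def)

text \<open>Concavity of \<open>ln\<close>. The chord is affine in \<open>l\<close>, so summing the
  inequality over eigenvalues leaves a bound in which only their sum, the trace, appears.\<close>

lemma ln_ge_chord:
  fixes x y l :: real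
  assumes "0 < y" "y < x" "y \<le> l" "l \<le> x"
  shows "((x - l) * ln y + (l - y) * ln x) / (x - y) \<le> ln l"
proof -
  define u where "u = (l - y) / (x - y)"
  have u: "0 \<le> u" "u \<le> 1" using assms by (auto simp: u_def field_simps)
  have "u * (x - y) = l - y" using assms by (simp add: u_def)
  then have l: "l = (1 - u) * y + u * x" by (simp add: algebra_simps)
  have "concave_on {0<..} (ln :: real \<Rightarrow> real)" by (rule ln_concave)
  then have "(1 - u) * ln y + u * ln x \<le> ln ((1 - u) *\<^sub>R y + u *\<^sub>R x)"
    using u assms by (intro concave_onD) auto
  moreover have "((x - l) * ln y + (l - y) * ln x) / (x - y) = (1 - u) * ln y + u * ln x"
  proof -
    have "1 - u = (x - l) / (x - y)" using assms by (simp add: u_def field_simps)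
    then show ?thesis by (simp add: u_def add_divide_distrib)
  qed
  ultimately show ?thesis using l by simp
qed

lemma trace_similar:
  fixes A B :: "'a::comm_ring_1 mat"
  assumes "similar_mat A B" and A: "A \<in> carrier_mat n n"
  shows "(\<Sum>i<n. A $$ (i,i)) = (\<Sum>i<n. B $$ (i,i))"
proof -
  from assms(1) obtain P Q where "similar_mat_wit A B P Q" by (auto simp: similar_mat_def)
  from similar_mat_witD2[OF A this] have
    c: "B \<in> carrier_mat n n" "P \<in> carrier_mat n n" "Q \<in> carrier_mat n n"
    and QP: "Q * P = 1\<^sub>m n" and AB: "A = P * B * Q" by auto
  have tr: "(\<Sum>i<n. (X * Y) $$ (i,i)) = (\<Sum>i<n. (Y * X) $$ (i,i))"
    if "X \<in> carrier_mat n n" "Y \<in> carrier_mat n n" for X Y :: "'a mat"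
  proof -
    have "(\<Sum>i<n. (X * Y) $$ (i,i)) = (\<Sum>i<n. \<Sum>j<n. X $$ (i,j) * Y $$ (j,i))"
      using that by (auto simp: scalar_prod_def lessThan_atLeast0 intro!: sum.cong)
    also have "\<dots> = (\<Sum>j<n. \<Sum>i<n. X $$ (i,j) * Y $$ (j,i))" by (rule sum.swap)
    also have "\<dots> = (\<Sum>i<n. (Y * X) $$ (i,i))"
      using that by (auto simp: scalar_prod_def lessThan_atLeast0 mult.commute intro!: sum.cong)
    finally show ?thesis .
  qed
  have "(\<Sum>i<n. A $$ (i,i)) = (\<Sum>i<n. (Q * (P * B)) $$ (i,i))"
    unfolding AB using c by (intro tr) auto
  also have "Q * (P * B) = Q * P * B" using c by (simp add: assoc_mult_mat[of _ n n _ n _ n])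
  also have "\<dots> = B" using c QP by simp
  finally show ?thesis .
qed

lemma eigenvalue_between:
  fixes Q :: cmat
  assumes Q: "\<And>v. Im (qform n Q v) = 0 \<and> y * sqnorm {..<n} v \<le> Re (qform n Q v)
      \<and> Re (qform n Q v) \<le> x * sqnorm {..<n} v"
    and ev: "eigenvalue (mat n n (\<lambda>(i,j). Q i j)) e"
  shows "Im e = 0" "y \<le> Re e" "Re e \<le> x"
proof -
  let ?A = "mat n n (\<lambda>(i,j). Q i j)"
  from ev obtain w where w: "w \<in> carrier_vec n" "w \<noteq> 0\<^sub>v n" "?A *\<^sub>v w = e \<cdot>\<^sub>v w"
    by (auto simp: eigenvalue_def eigenvector_def)
  define v where "v = (\<lambda>i. w $ i)"
  have Aw: "(\<Sum>j<n. Q i j * v j) = e * v i" if "i < n" for i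
  proof -
    have "(?A *\<^sub>v w) $ i = (\<Sum>j<n. Q i j * v j)"
      using that w(1) by (auto simp: scalar_prod_def lessThan_atLeast0 v_def intro!: sum.cong)
    then show ?thesis using w that by (simp add: v_def)
  qed
  have "qform n Q v = (\<Sum>i<n. cnj (v i) * (\<Sum>j<n. Q i j * v j))"
    by (simp add: qform_def sum_distrib_left mult.assoc)
  also have "\<dots> = (\<Sum>i<n. e * of_real ((cmod (v i))\<^sup>2))"
    using Aw by (intro sum.cong) (auto simp: complex_norm_square mult_ac simp del: of_real_power)
  also have "\<dots> = e * of_real (sqnorm {..<n} v)" by (simp add: sqnorm_def sum_distrib_left)
  finally have f: "qform n Q v = e * of_real (sqnorm {..<n} v)" .
  obtain i where "i < n" "v i \<noteq> 0"
    using w(1,2) by (metis carrier_vecD eq_vecI index_zero_vec(1) index_zero_vec(2) v_def)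
  then have pos: "0 < sqnorm {..<n} v" unfolding sqnorm_def by (intro sum_pos2[of _ i]) auto
  show "Im e = 0" "y \<le> Re e" "Re e \<le> x"
    using Q[of v] pos unfolding f by auto
qed

text \<open>Schur triangularisation exposes the eigenvalues, which the form bounds confine to the
  real interval [y,x]; \<open>ln\<close> of the determinant is then a sum of logarithms, each above
  the chord. Equality holds when every eigenvalue is an endpoint.\<close>

lemma det_ge_of_trace:
  fixes Q :: cmat
  assumes xy: "0 < y" "y < x"
    and Q: "\<And>v. Im (qform n Q v) = 0 \<and> y * sqnorm {..<n} v \<le> Re (qform n Q v)
      \<and> Re (qform n Q v) \<le> x * sqnorm {..<n} v"
  shows "exp (((n * x - Re (mtrace n Q)) * ln y + (Re (mtrace n Q) - n * y) * ln x) / (x - y))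
    \<le> Re (det (mat n n (\<lambda>(i,j). Q i j)))"
proof -
  let ?A = "mat n n (\<lambda>(i,j). Q i j)"
  have A: "?A \<in> carrier_mat n n" by simp
  obtain es where es: "char_poly ?A = (\<Prod>a\<leftarrow>es. [:- a, 1:])"
    using char_poly_factorized[OF A] by blast
  obtain B where B: "B \<in> carrier_mat n n" "upper_triangular B" "similar_mat ?A B"
    using schur_decomposition_exists[OF A es] by blast
  define b where "b = (\<lambda>i. Re (B $$ (i,i)))"
  have ev: "Im (B $$ (i,i)) = 0 \<and> y \<le> b i \<and> b i \<le> x" if "i < n" for i
  proof -
    have "B $$ (i,i) \<in> set (diag_mat B)" using B(1) that by (auto simp: diag_mat_def)
    then have "poly (char_poly B) (B $$ (i,i)) = 0"
      by (subst char_poly_upper_triangular[OF B(1,2)])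
        (auto simp: poly_prod_list prod_list_zero_iff image_iff intro!: bexI)
    then have "eigenvalue ?A (B $$ (i,i))"
      using eigenvalue_root_char_poly[OF A] char_poly_similar[OF B(3)] by simp
    from eigenvalue_between[OF Q this] show ?thesis by (simp add: b_def)
  qed
  have Bb: "B $$ (i,i) = of_real (b i)" if "i < n" for i
    using ev[OF that] by (simp add: b_def complex_eq_iff)
  have bpos: "0 < b i" if "i < n" for i using ev[OF that] xy by linarith
  have "det ?A = prod_list (diag_mat B)"
    using det_similar[OF B(3)] det_upper_triangular[OF B(2,1)] by simp
  also have "\<dots> = (\<Prod>i<n. B $$ (i,i))"
    using B(1) by (simp add: diag_mat_def prod.list_conv_set_nth lessThan_atLeast0)
  also have "\<dots> = of_real (\<Prod>i<n. b i)" using Bb by simp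
  finally have det: "det ?A = of_real (\<Prod>i<n. b i)" .
  have "mtrace n Q = (\<Sum>i<n. ?A $$ (i,i))" by (simp add: mtrace_def)
  also have "\<dots> = (\<Sum>i<n. of_real (b i))" using trace_similar[OF B(3) A] Bb by simp
  finally have tr: "Re (mtrace n Q) = (\<Sum>i<n. b i)" by simp
  have "((n * x - (\<Sum>i<n. b i)) * ln y + ((\<Sum>i<n. b i) - n * y) * ln x) / (x - y)
      = (\<Sum>i<n. ((x - b i) * ln y + (b i - y) * ln x) / (x - y))"
    unfolding sum_divide_distrib[symmetric] sum.distrib sum_distrib_right[symmetric] sum_subtractf
    by simp
  also have "\<dots> \<le> (\<Sum>i<n. ln (b i))"
    using ev by (intro sum_mono ln_ge_chord xy) auto
  finally have "exp (((n * x - (\<Sum>i<n. b i)) * ln y + ((\<Sum>i<n. b i) - n * y) * ln x) / (x - y))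
     \<le> exp (\<Sum>i<n. ln (b i))" by simp
  also have "\<dots> = (\<Prod>i<n. b i)" using bpos by (simp add: exp_sum)
  finally show ?thesis by (simp only: det tr Re_complex_of_real)
qed

text \<open>One step of Gaussian elimination: a unipotent block matrix clears the last column above
  the pivot. The block that remains is the Schur complement, the same matrix that completing the
  square produces.\<close>

lemma det_schur_step:
  fixes Q :: cmat
  assumes "Q n n \<noteq> 0"
  shows "det (mat (Suc n) (Suc n) (\<lambda>(i,j). Q i j)) =
    Q n n * det (mat n n (\<lambda>(i,j). Q i j - Q i n * Q n j / Q n n))"
proof -
  define b where "b = mat n 1 (\<lambda>(i,j). - Q i n / Q n n)"
  let ?L = "four_block_mat (1\<^sub>m n) b (0\<^sub>m 1 n) (1\<^sub>m 1)"
  let ?B = "mat n 1 (\<lambda>(i,j). Q i n)" and ?C = "mat 1 n (\<lambda>(i,j). Q n j)"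
    and ?D = "mat 1 1 (\<lambda>(i,j). Q n n)" and ?Q = "mat n n (\<lambda>(i,j). Q i j)"
  let ?A = "four_block_mat ?Q ?B ?C ?D"
  let ?S = "mat n n (\<lambda>(i,j). Q i j - Q i n * Q n j / Q n n)"
  have A: "mat (Suc n) (Suc n) (\<lambda>(i,j). Q i j) = ?A"
    by (rule eq_matI) (auto simp: less_Suc_eq)
  have LA: "?L * ?A = four_block_mat ?S (0\<^sub>m n 1) ?C ?D"
  proof -
    have "?L * ?A = four_block_mat (1\<^sub>m n * ?Q + b * ?C) (1\<^sub>m n * ?B + b * ?D)
      (0\<^sub>m 1 n * ?Q + 1\<^sub>m 1 * ?C) (0\<^sub>m 1 n * ?B + 1\<^sub>m 1 * ?D)"
      by (rule mult_four_block_mat) (auto simp: b_def)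
    moreover have "1\<^sub>m n * ?Q + b * ?C = ?S"
      by (rule eq_matI) (auto simp: b_def scalar_prod_def)
    moreover have "1\<^sub>m n * ?B + b * ?D = 0\<^sub>m n 1"
      using assms by (intro eq_matI) (auto simp: b_def scalar_prod_def)
    moreover have "0\<^sub>m 1 n * ?Q + 1\<^sub>m 1 * ?C = ?C" by (rule eq_matI) auto
    moreover have "0\<^sub>m 1 n * ?B + 1\<^sub>m 1 * ?D = ?D" by (rule eq_matI) auto
    ultimately show ?thesis by simp
  qed
  have "det ?L = 1"
    by (subst det_four_block_mat_lower_left_zero[of _ n _ 1]) (auto simp: b_def)
  moreover have "det (?L * ?A) = det ?L * det ?A"
    by (rule det_mult[of _ "n+1"]) (auto simp: b_def)
  moreover have "det (four_block_mat ?S (0\<^sub>m n 1) ?C ?D) = det ?S * det ?D"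
    by (rule det_four_block_mat_upper_right_zero[of _ n _ 1]) auto
  moreover have "det ?D = Q n n" by (simp add: det_single)
  ultimately show ?thesis using A LA by (simp add: mult.commute)
qed

section \<open>Volumes of ellipsoids and concentration on the sphere\<close>

lemma qform_two:
  assumes "i < n" "j < n" "i \<noteq> j"
  shows "qform n Q (\<lambda>k. if k = i then s else if k = j then t else 0) =
    cnj s * Q i i * s + cnj s * Q i j * t + cnj t * Q j i * s + cnj t * Q j j * t"
proof -
  let ?v = "\<lambda>k. if k = i then s else if k = j then t else 0"
  have *: "(\<Sum>k<n. g k (?v k)) = g i s + g j t"
    if "\<And>k. g k 0 = 0" for g :: "nat \<Rightarrow> complex \<Rightarrow> complex"
  proof -
    have "(\<Sum>k<n. g k (?v k)) = (\<Sum>k\<in>{i,j}. g k (?v k))"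
      using assms that by (intro sum.mono_neutral_right) auto
    then show ?thesis using assms by simp
  qed
  have "qform n Q ?v = (\<Sum>a<n. cnj (?v a) * Q a i * s + cnj (?v a) * Q a j * t)"
    unfolding qform_def by (intro sum.cong refl, subst *) auto
  also have "\<dots> = cnj s * Q i i * s + cnj s * Q i j * t + (cnj t * Q j i * s + cnj t * Q j j * t)"
    by (rule *[of "\<lambda>k z. cnj z * Q k i * s + cnj z * Q k j * t"]) simp
  finally show ?thesis by (simp add: add.assoc)
qed

lemma qform_single:
  assumes "i < n"
  shows "qform n Q (\<lambda>k. if k = i then 1 else 0) = Q i i"
proof -
  have "qform n Q (\<lambda>k. if k = i then 1 else 0)
      = (\<Sum>a<n. if a = i then \<Sum>b<n. (if b = i then Q a b else 0) else 0)"
    unfolding qform_def by (intro sum.cong refl) (auto simp: if_distrib cong: if_cong)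
  then show ?thesis using assms by simp
qed

text \<open>Polarisation: the test vectors \<open>e_i + e_j\<close> and \<open>e_i + i e_j\<close>
  determine the imaginary part of the sum and the real part of the difference of the two
  off-diagonal entries.\<close>

lemma hermitian_of_real_qform:
  assumes "\<And>v. Im (qform n Q v) = 0" "i < n" "j < n"
  shows "Q j i = cnj (Q i j)"
proof (cases "i = j")
  case True
  then show ?thesis using assms(1)[of "\<lambda>k. if k = i then 1 else 0"] qform_single[OF assms(2), of Q]
    by (simp add: complex_eq_iff)
next
  case False
  have d: "Im (Q i i) = 0" "Im (Q j j) = 0"
    using assms(1)[of "\<lambda>k. if k = i then 1 else 0"] qform_single[OF assms(2), of Q]
      assms(1)[of "\<lambda>k. if k = j then 1 else 0"] qform_single[OF assms(3), of Q] by auto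
  show ?thesis
    using assms(1)[of "\<lambda>k. if k = i then 1 else if k = j then 1 else 0"]
      assms(1)[of "\<lambda>k. if k = i then 1 else if k = j then \<i> else 0"] d
    unfolding qform_two[OF assms(2,3) False] by (simp add: complex_eq_iff)
qed

lemma qform_cong: "(\<And>i. i < n \<Longrightarrow> v i = w i) \<Longrightarrow> qform n Q v = qform n Q w"
  by (simp add: qform_def)

lemma qform_complete_square:
  fixes Q :: cmat
  assumes herm: "\<And>i. i < n \<Longrightarrow> Q i n = cnj (Q n i)" and q: "Q n n = of_real q" "q > 0"
  shows "qform (Suc n) Q v = of_real (q * (cmod (v n + (\<Sum>j<n. Q n j * v j) / of_real q))\<^sup>2)
    + qform n (\<lambda>i j. Q i j - Q i n * Q n j / Q n n) v"
proof -
  define b where "b = (\<Sum>j<n. Q n j * v j)"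
  have cb: "cnj b = (\<Sum>i<n. cnj (v i) * Q i n)"
    unfolding b_def cnj_sum using herm by (intro sum.cong) auto
  have 1: "qform (Suc n) Q v = qform n Q v + cnj b * v n + cnj (v n) * b + cnj (v n) * of_real q * v n"
    unfolding cb unfolding b_def
    by (simp add: qform_def sum.distrib q sum_distrib_left sum_distrib_right mult.assoc add_ac)
  have 2: "qform n (\<lambda>i j. Q i j - Q i n * Q n j / Q n n) v = qform n Q v - cnj b * b / of_real q"
  proof -
    have "cnj b * b / of_real q = (\<Sum>i<n. \<Sum>j<n. cnj (v i) * (Q i n * Q n j / of_real q) * v j)"
      unfolding cb unfolding b_def sum_product sum_divide_distrib by (simp add: mult_ac)
    then show ?thesis
      unfolding qform_def by (simp add: right_diff_distrib left_diff_distrib sum_subtractf q)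
  qed
  have 3: "of_real ((cmod z)\<^sup>2) = cnj z * z" for z by (metis complex_norm_square mult.commute)
  have "of_real (q * (cmod (v n + b / of_real q))\<^sup>2) =
      cnj b * v n + cnj (v n) * b + cnj (v n) * of_real q * v n + cnj b * b / of_real q"
    unfolding of_real_mult 3 using q(2) by (simp add: field_simps)
  then show ?thesis unfolding 1 2 b_def by simp
qed

lemma nn_integral_complex_affine:
  fixes t :: complex and g :: "complex \<Rightarrow> ennreal"
  assumes [measurable]: "g \<in> borel_measurable borel" and "c \<noteq> 0"
  shows "(\<integral>\<^sup>+z. g z \<partial>lborel) = ennreal (c\<^sup>2) * (\<integral>\<^sup>+z. g (t + c *\<^sub>R z) \<partial>lborel)"
proof -
  have "(\<integral>\<^sup>+z. g z \<partial>lborel)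
      = (\<integral>\<^sup>+z. g z \<partial>density (distr lborel borel (\<lambda>z. t + c *\<^sub>R z)) (\<lambda>_. ennreal (\<bar>c\<bar> ^ DIM(complex))))"
    using lborel_affine[OF assms(2), of t] by simp
  also have "\<dots> = (\<integral>\<^sup>+z. ennreal (\<bar>c\<bar> ^ DIM(complex)) * g (t + c *\<^sub>R z) \<partial>lborel)"
    by (simp add: nn_integral_density nn_integral_distr)
  also have "\<dots> = ennreal (c\<^sup>2) * (\<integral>\<^sup>+z. g (t + c *\<^sub>R z) \<partial>lborel)"
    by (simp add: nn_integral_cmult)
  finally show ?thesis .
qed

lemma measurable_component_lborel:
  "i \<in> I \<Longrightarrow> (\<lambda>v. v i) \<in> borel_measurable (PiM I (\<lambda>_. lborel :: complex measure))"
  using measurable_component_singleton[of i I "\<lambda>_. lborel"] by simp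

lemma borel_measurable_cnj [measurable]: "cnj \<in> borel_measurable borel"
  by (intro borel_measurable_continuous_onI continuous_intros)

lemma measurable_qform [measurable]:
  "qform n Q \<in> borel_measurable (PiM {..<n} (\<lambda>_. lborel))"
  unfolding qform_def[abs_def] by (intro borel_measurable_sum borel_measurable_times)
    (auto intro: measurable_compose[OF _ borel_measurable_cnj] measurable_component_lborel)

lemma measurable_sqnorm [measurable]:
  "sqnorm I \<in> borel_measurable (PiM I (\<lambda>_. lborel))"
  unfolding sqnorm_def[abs_def] by (intro borel_measurable_sum borel_measurable_power borel_measurable_norm)
    (auto intro: measurable_component_lborel)

lemma sigma_finite_cvec:
  "finite I \<Longrightarrow> sigma_finite_measure (PiM I (\<lambda>_. lborel :: complex measure))"
  by (rule product_sigma_finite.sigma_finite) (auto simp: product_sigma_finite_def sigma_finite_lborel)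

text \<open>Each step of the induction eliminates one coordinate by completing the square; the pivots
  multiply up to the determinant.\<close>

lemma nn_integral_qform:
  fixes Q :: cmat
  assumes "0 < y"
    and "\<And>v. Im (qform n Q v) = 0 \<and> y * sqnorm {..<n} v \<le> Re (qform n Q v)"
    and "f \<in> borel_measurable borel"
  shows "0 < Re (det (mat n n (\<lambda>(i,j). Q i j))) \<and>
    ennreal (Re (det (mat n n (\<lambda>(i,j). Q i j)))) *
      (\<integral>\<^sup>+v. f (Re (qform n Q v)) \<partial>PiM {..<n} (\<lambda>_. lborel))
    = (\<integral>\<^sup>+v. f (sqnorm {..<n} v) \<partial>PiM {..<n} (\<lambda>_. lborel))"
  using assms(2,3)
proof (induction n arbitrary: Q f)
  case 0
  then show ?case by (simp add: qform_def sqnorm_def)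
next
  case (Suc n Q f)
  note [measurable] = Suc.prems(2)
  interpret product_sigma_finite "\<lambda>_::nat. lborel :: complex measure"
    by (simp add: product_sigma_finite_def sigma_finite_lborel)
  let ?M = "PiM {..<n} (\<lambda>_. lborel :: complex measure)"
  interpret pair_sigma_finite ?M "lborel :: complex measure"
    by (intro pair_sigma_finite.intro sigma_finite_cvec sigma_finite_lborel) simp
  have herm: "Q i n = cnj (Q n i)" if "i < n" for i
    using hermitian_of_real_qform[of "Suc n" Q n i] Suc.prems(1) that by simp
  define q where "q = Re (Q n n)"
  have "qform (Suc n) Q (\<lambda>k. if k = n then 1 else 0) = Q n n" by (rule qform_single) simp
  moreover have "sqnorm {..<Suc n} (\<lambda>k. if k = n then 1 else 0) = 1" by (simp add: sqnorm_def)
  ultimately have q: "Q n n = of_real q" "q > 0"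
    using Suc.prems(1)[of "\<lambda>k. if k = n then 1 else 0"] assms(1)
    by (auto simp: q_def complex_eq_iff)
  define S where "S = (\<lambda>i j. Q i j - Q i n * Q n j / Q n n)"
  define b where "b = (\<lambda>v. (\<Sum>j<n. Q n j * v j) / of_real q)"
  have b_upd: "b (v(n := z)) = b v" for v z by (simp add: b_def)
  have cs: "qform (Suc n) Q v = of_real (q * (cmod (v n + b v))\<^sup>2) + qform n S v" for v
    unfolding S_def b_def by (intro qform_complete_square herm q)
  have S: "Im (qform n S v) = 0 \<and> y * sqnorm {..<n} v \<le> Re (qform n S v)" for v
  proof -
    \<comment> \<open>This last coordinate makes the completed square vanish, so the Schur
      complement at \<open>v\<close> is a value of the full form and inherits the lower bound
      \<open>y\<close>.\<close>
    let ?w = "v(n := - b v)"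
    have "qform (Suc n) Q ?w = qform n S ?w" unfolding cs b_upd by simp
    also have "\<dots> = qform n S v" by (rule qform_cong) simp
    finally have "qform (Suc n) Q ?w = qform n S v" .
    moreover have "sqnorm {..<n} v \<le> sqnorm {..<Suc n} ?w"
      unfolding sqnorm_def by simp
    then have "y * sqnorm {..<n} v \<le> y * sqnorm {..<Suc n} ?w"
      using assms(1) by (intro mult_left_mono) auto
    ultimately show ?thesis using Suc.prems(1)[of "v(n := - b v)"] by (auto simp del: fun_upd_apply)
  qed
  let ?D = "det (mat n n (\<lambda>(i,j). S i j))"
  have det: "Re (det (mat (Suc n) (Suc n) (\<lambda>(i,j). Q i j))) = q * Re ?D"
    using det_schur_step[of Q n] q by (simp add: S_def)
  \<comment> \<open>Positivity of the determinant is part of the induction hypothesis and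
    independent of \<open>f\<close>; any measurable function will do.\<close>
  have Dpos: "0 < Re ?D" using Suc.IH[of S "\<lambda>_. 0"] S by simp
  have ins: "{..<Suc n} = insert n {..<n}" by auto
  have mQ: "(\<lambda>v. f (Re (qform (Suc n) Q v))) \<in> borel_measurable (PiM (insert n {..<n}) (\<lambda>_. lborel))"
    using measurable_qform[of "Suc n" Q] unfolding ins by measurable
  have ms: "(\<lambda>v. f (sqnorm {..<Suc n} v)) \<in> borel_measurable (PiM (insert n {..<n}) (\<lambda>_. lborel))"
    unfolding ins by measurable
  have sq: "sqnorm {..<Suc n} (v(n := z)) = (cmod z)\<^sup>2 + sqnorm {..<n} v" for v z
    by (simp add: sqnorm_def)
  have inner: "ennreal q * (\<integral>\<^sup>+z. f (Re (qform (Suc n) Q (v(n := z)))) \<partial>lborel)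
      = (\<integral>\<^sup>+z. f ((cmod z)\<^sup>2 + Re (qform n S v)) \<partial>lborel)" for v
  proof -
    have "(\<integral>\<^sup>+z. f ((cmod z)\<^sup>2 + Re (qform n S v)) \<partial>lborel) = ennreal ((sqrt q)\<^sup>2) *
      (\<integral>\<^sup>+z. f ((cmod (of_real (sqrt q) * b v + sqrt q *\<^sub>R z))\<^sup>2 + Re (qform n S v)) \<partial>lborel)"
      using q(2) by (intro nn_integral_complex_affine) auto
    moreover have "(cmod (of_real (sqrt q) * b v + sqrt q *\<^sub>R z))\<^sup>2 = q * (cmod (z + b v))\<^sup>2" for z
    proof -
      have "of_real (sqrt q) * b v + sqrt q *\<^sub>R z = sqrt q *\<^sub>R (z + b v)"
        by (simp add: scaleR_conv_of_real algebra_simps)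
      then show ?thesis using q(2) by (simp add: power_mult_distrib)
    qed
    moreover have "Re (qform (Suc n) Q (v(n := z))) = q * (cmod (z + b v))\<^sup>2 + Re (qform n S v)" for z
    proof -
      have "qform n S (v(n := z)) = qform n S v" by (rule qform_cong) simp
      then show ?thesis unfolding cs b_upd by simp
    qed
    ultimately show ?thesis using q(2) by simp
  qed
  have mz: "(\<lambda>(v, z). f ((cmod z)\<^sup>2 + Re (qform n S v))) \<in> borel_measurable (?M \<Otimes>\<^sub>M lborel)"
    by measurable
  have mz_swap: "(\<lambda>(z, v). f ((cmod z)\<^sup>2 + Re (qform n S v))) \<in> borel_measurable (lborel \<Otimes>\<^sub>M ?M)"
    by measurable
  have mz': "(\<lambda>(v, z). f ((cmod z)\<^sup>2 + sqnorm {..<n} v)) \<in> borel_measurable (?M \<Otimes>\<^sub>M lborel)"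
    by measurable
  \<comment> \<open>Measurability is transported through \<open>inner\<close>: up to the factor
    \<open>1/q\<close> the integral equals one whose integrand is jointly measurable in
    \<open>v\<close> and \<open>z\<close>.\<close>
  have mQ1: "(\<lambda>v. \<integral>\<^sup>+z. f (Re (qform (Suc n) Q (v(n := z)))) \<partial>lborel) \<in> borel_measurable ?M"
  proof -
    have "(\<lambda>v. \<integral>\<^sup>+z. f (Re (qform (Suc n) Q (v(n := z)))) \<partial>lborel)
      = (\<lambda>v. ennreal (inverse q) * (\<integral>\<^sup>+z. f ((cmod z)\<^sup>2 + Re (qform n S v)) \<partial>lborel))"
      unfolding inner[symmetric] mult.assoc[symmetric]
      using q(2) by (simp add: ennreal_mult[symmetric])
    moreover have "(\<lambda>v. \<integral>\<^sup>+z. f ((cmod z)\<^sup>2 + Re (qform n S v)) \<partial>lborel) \<in> borel_measurable ?M"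
      using mz by (rule lborel.borel_measurable_nn_integral)
    ultimately show ?thesis by (simp add: borel_measurable_times)
  qed
  have "ennreal (q * Re ?D) * (\<integral>\<^sup>+v. f (Re (qform (Suc n) Q v)) \<partial>PiM {..<Suc n} (\<lambda>_. lborel))
      = ennreal (Re ?D) * (ennreal q * (\<integral>\<^sup>+v. \<integral>\<^sup>+z. f (Re (qform (Suc n) Q (v(n := z)))) \<partial>lborel \<partial>?M))"
    unfolding ins using q(2) Dpos mQ
    by (subst product_nn_integral_insert) (auto simp: ennreal_mult ins mult_ac)
  also have "\<dots> = ennreal (Re ?D) * (\<integral>\<^sup>+v. \<integral>\<^sup>+z. f ((cmod z)\<^sup>2 + Re (qform n S v)) \<partial>lborel \<partial>?M)"
    by (subst nn_integral_cmult[symmetric]) (auto simp: mQ1 inner)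
  \<comment> \<open>With \<open>z\<close> outside and fixed, the induction hypothesis applies to
    \<open>f\<close> shifted by \<open>(cmod z)^2\<close>. Afterwards the order of integration is
    restored.\<close>
  also have "\<dots> = ennreal (Re ?D) * (\<integral>\<^sup>+z. \<integral>\<^sup>+v. f ((cmod z)\<^sup>2 + Re (qform n S v)) \<partial>?M \<partial>lborel)"
    by (subst Fubini'[OF mz]) simp
  also have "\<dots> = (\<integral>\<^sup>+z. ennreal (Re ?D) * (\<integral>\<^sup>+v. f ((cmod z)\<^sup>2 + Re (qform n S v)) \<partial>?M) \<partial>lborel)"
    by (intro nn_integral_cmult[symmetric] M1.borel_measurable_nn_integral mz_swap)
  also have "\<dots> = (\<integral>\<^sup>+z. \<integral>\<^sup>+v. f ((cmod z)\<^sup>2 + sqnorm {..<n} v) \<partial>?M \<partial>lborel)"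
    using Suc.IH[of S "\<lambda>x. f (_ + x)"] S by (intro nn_integral_cong) simp
  also have "\<dots> = (\<integral>\<^sup>+v. \<integral>\<^sup>+z. f ((cmod z)\<^sup>2 + sqnorm {..<n} v) \<partial>lborel \<partial>?M)"
    by (subst Fubini'[OF mz']) simp
  also have "\<dots> = (\<integral>\<^sup>+v. f (sqnorm {..<Suc n} v) \<partial>PiM (insert n {..<n}) (\<lambda>_. lborel))"
    using ms by (subst product_nn_integral_insert) (auto simp: sq)
  finally show ?case unfolding det using q(2) Dpos by (simp only: ins mult_pos_pos)
qed

text \<open>Pinsker's inequality for two Bernoulli laws. The difference of the sides vanishes at
  \<open>t = p\<close> and has derivative \<open>(u - p) (1 / (u (1 - u)) - 4)\<close>, nonnegative
  because \<open>u (1 - u) \<le> 1/4\<close>.\<close>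

lemma binary_pinsker:
  fixes p t :: real
  assumes "0 < p" "p \<le> t" "t < 1"
  shows "2 * (t - p)\<^sup>2 \<le> p * ln (p / t) + (1 - p) * ln ((1 - p) / (1 - t))"
proof -
  define g where "g = (\<lambda>u. p * (ln p - ln u) + (1 - p) * (ln (1 - p) - ln (1 - u)) - 2 * (u - p)\<^sup>2)"
  have "g p \<le> g t"
  proof (rule DERIV_nonneg_imp_nondecreasing[OF assms(2)])
    fix u assume u: "p \<le> u" "u \<le> t"
    have "(g has_real_derivative (p * (0 - 1 / u) + (1 - p) * (0 - 1 / (1 - u) * (0 - 1)) - 2 * (2 * (u - p)))) (at u)"
      unfolding g_def using u assms by (auto intro!: derivative_eq_intros)
    then have "(g has_real_derivative (- p / u + (1 - p) / (1 - u) - 4 * (u - p))) (at u)"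
      by simp
    moreover have "0 \<le> - p / u + (1 - p) / (1 - u) - 4 * (u - p)"
    proof -
      have 1: "- p / u + (1 - p) / (1 - u) = (u - p) / (u * (1 - u))"
        using u assms by (simp add: field_simps)
      have "4 * (u * (1 - u)) \<le> 1"
        using zero_le_power2[of "2 * u - 1"] by (simp add: power2_eq_square algebra_simps)
      then have "4 * (u - p) * (u * (1 - u)) \<le> u - p"
        using mult_left_mono[of "4 * (u * (1 - u))" 1 "u - p"] u by (simp add: algebra_simps)
      then show ?thesis unfolding 1 using u assms by (simp add: pos_le_divide_eq)
    qed
    ultimately show "\<exists>y. (g has_real_derivative y) (at u) \<and> 0 \<le> y" by blast
  qed
  then show ?thesis using assms by (simp add: g_def ln_div)
qed

abbreviation cprod :: "'i set \<Rightarrow> ('i \<Rightarrow> complex) measure" where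
  "cprod I \<equiv> PiM I (\<lambda>_. lborel)"

lemma product_sigma_finite_lborel: "product_sigma_finite (\<lambda>_. lborel :: complex measure)"
  by (simp add: product_sigma_finite_def sigma_finite_lborel)

lemma emeasure_polydisc:
  assumes "finite I" "0 < r"
  shows "0 < emeasure (cprod I) (PiE I (\<lambda>_. cball (0::complex) r))"
    "emeasure (cprod I) (PiE I (\<lambda>_. cball (0::complex) r)) < \<infinity>"
    "PiE I (\<lambda>_. cball (0::complex) r) \<in> sets (cprod I)"
proof -
  have "0 < measure lborel (cball (0::complex) r)" using assms by (intro content_cball_pos)
  then have 1: "0 < emeasure lborel (cball (0::complex) r)"
    by (metis enn2real_0 measure_def not_gr_zero less_irrefl)
  have 2: "emeasure lborel (cball (0::complex) r) < \<infinity>"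
    using emeasure_bounded_finite[of "cball (0::complex) r"] by simp
  have 3: "emeasure (cprod I) (PiE I (\<lambda>_. cball (0::complex) r)) = emeasure lborel (cball (0::complex) r) ^ card I"
    using assms by (subst product_sigma_finite.emeasure_PiM[OF product_sigma_finite_lborel]) auto
  show "0 < emeasure (cprod I) (PiE I (\<lambda>_. cball (0::complex) r))"
    unfolding 3 using 1 by (metis ennreal_zero_less_mult_iff power_eq_0_iff zero_less_iff_neq_zero)
  show "emeasure (cprod I) (PiE I (\<lambda>_. cball (0::complex) r)) < \<infinity>"
    unfolding 3 using 2 by (simp add: power_less_top_ennreal)
  show "PiE I (\<lambda>_. cball (0::complex) r) \<in> sets (cprod I)"
    using assms by (intro sets_PiM_I_finite) auto
qed

lemma cmod_le_sqnorm: "finite I \<Longrightarrow> i \<in> I \<Longrightarrow> (cmod (v i))\<^sup>2 \<le> sqnorm I v"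
  unfolding sqnorm_def by (rule member_le_sum) auto

lemma sqnorm_nonneg: "0 \<le> sqnorm I v"
  by (simp add: sqnorm_def sum_nonneg)

lemma vnorm_sqnorm: "vnorm d v = sqrt (sqnorm {..<d} v)"
  by (simp add: vnorm_def sqnorm_def)

lemma measurable_unit_ball: "{v \<in> space (cprod I). sqnorm I v \<le> 1} \<in> sets (cprod I)"
  by measurable

lemma emeasure_unit_ball:
  assumes "finite I"
  shows "0 < emeasure (cprod I) {v \<in> space (cprod I). sqnorm I v \<le> 1}"
    "emeasure (cprod I) {v \<in> space (cprod I). sqnorm I v \<le> 1} < \<infinity>"
proof -
  let ?B = "{v \<in> space (cprod I). sqnorm I v \<le> 1}"
  define r where "r = 1 / sqrt (card I + 1)"
  have r: "0 < r" by (simp add: r_def)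
  have "PiE I (\<lambda>_. cball (0::complex) r) \<subseteq> ?B"
  proof
    fix v assume v: "v \<in> PiE I (\<lambda>_. cball (0::complex) r)"
    have "sqnorm I v \<le> (\<Sum>i\<in>I. r\<^sup>2)"
      unfolding sqnorm_def using v by (intro sum_mono power_mono) auto
    also have "\<dots> \<le> 1" by (simp add: r_def power_divide field_simps)
    finally show "v \<in> ?B" using v by (auto simp: space_PiM)
  qed
  then have "emeasure (cprod I) (PiE I (\<lambda>_. cball (0::complex) r)) \<le> emeasure (cprod I) ?B"
    by (intro emeasure_mono measurable_unit_ball)
  then show "0 < emeasure (cprod I) ?B"
    using emeasure_polydisc(1)[OF assms r] by (rule less_le_trans[rotated])
  have "?B \<subseteq> PiE I (\<lambda>_. cball (0::complex) 1)"
  proof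
    fix v assume v: "v \<in> ?B"
    have "cmod (v i) \<le> 1" if "i \<in> I" for i
    proof -
      have "(cmod (v i))\<^sup>2 \<le> 1" using cmod_le_sqnorm[OF assms that, of v] v by simp
      then show ?thesis by (simp add: abs_square_le_1)
    qed
    then show "v \<in> PiE I (\<lambda>_. cball (0::complex) 1)" using v by (auto simp: space_PiM)
  qed
  then have "emeasure (cprod I) ?B \<le> emeasure (cprod I) (PiE I (\<lambda>_. cball (0::complex) 1))"
    using emeasure_polydisc(3)[OF assms, of 1] by (intro emeasure_mono) auto
  then show "emeasure (cprod I) ?B < \<infinity>"
    using emeasure_polydisc(2)[OF assms, of 1] by (simp add: le_less_trans)
qed

lemma qform_id_minus:
  "qform d (\<lambda>i j. of_real x * (if i = j then 1 else 0) - of_real s * W i j) v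
    = of_real (x * sqnorm {..<d} v) - of_real s * qform d W v"
proof -
  have "qform d (\<lambda>i j. of_real x * (if i = j then 1 else 0) - of_real s * W i j) v
    = (\<Sum>i<d. \<Sum>j<d. if i = j then of_real x * (cnj (v i) * v i) else 0) - of_real s * qform d W v"
    unfolding qform_def sum_distrib_left sum_subtractf[symmetric]
    by (intro sum.cong refl) (simp add: algebra_simps)
  also have "(\<Sum>i<d. \<Sum>j<d. if i = j then of_real x * (cnj (v i) * v i) else 0)
    = (\<Sum>i<d. of_real (x * (cmod (v i))\<^sup>2))"
    by (intro sum.cong) (auto simp: complex_norm_square mult_ac simp del: of_real_power)
  finally show ?thesis by (simp add: sqnorm_def sum_distrib_left)
qed

text \<open>On the unit ball, the cone where \<open>W\<close> has Rayleigh quotient at least \<open>t\<close> lies in the ellipsoid of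
  \<open>x - (x - y) W\<close>. The choice of \<open>x\<close> and \<open>y\<close> minimises the ellipsoid's volume, which makes the
  exponent the relative entropy of \<open>(p, 1 - p)\<close> with respect to \<open>(t, 1 - t)\<close>.\<close>

lemma measure_cone_le:
  fixes W :: cmat
  assumes W: "\<And>v. Im (qform d W v) = 0 \<and> 0 \<le> Re (qform d W v) \<and> Re (qform d W v) \<le> sqnorm {..<d} v"
    and tr: "Re (mtrace d W) \<le> p * d" and p: "0 < p" "p < t" "t < 1"
  shows "measure (cprod {..<d}) {v \<in> space (cprod {..<d}). sqnorm {..<d} v \<le> 1 \<and>
      t * sqnorm {..<d} v \<le> Re (qform d W v)}
    \<le> exp (- 2 * real d * (t - p)\<^sup>2) * measure (cprod {..<d}) {v \<in> space (cprod {..<d}). sqnorm {..<d} v \<le> 1}"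
    (is "measure ?M ?C \<le> _ * measure ?M ?B")
proof -
  define x where "x = (1 - p) / (1 - t)"
  define y where "y = p / t"
  define s where "s = (t - p) / (t * (1 - t))"
  \<comment> \<open>The relation \<open>x - 1 = s t\<close> is what places the cone in the
    ellipsoid: where \<open>W\<close> is at least \<open>t\<close> times the square norm, the form
    of \<open>x - s W\<close> is at most the square norm.\<close>
  have s: "0 < s" "x - y = s" "x - 1 = s * t"
    using p by (auto simp: s_def x_def y_def field_simps)
  have xy: "0 < y" "y < x" using s p by (auto simp: y_def)
  define Q where "Q = (\<lambda>i j. of_real x * (if i = j then 1 else 0) - of_real s * W i j)"
  have Qf: "qform d Q v = of_real (x * sqnorm {..<d} v) - of_real s * qform d W v" for v
    unfolding Q_def by (rule qform_id_minus)
  have Q: "Im (qform d Q v) = 0 \<and> y * sqnorm {..<d} v \<le> Re (qform d Q v)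
      \<and> Re (qform d Q v) \<le> x * sqnorm {..<d} v" for v
  proof -
    have "s * Re (qform d W v) \<le> s * sqnorm {..<d} v" "0 \<le> s * Re (qform d W v)"
      using W[of v] s(1) by auto
    moreover have "y = x - s" using s by simp
    ultimately show ?thesis using W[of v] by (simp add: Qf left_diff_distrib)
  qed
  let ?D = "Re (det (mat d d (\<lambda>(i,j). Q i j)))"
  have trQ: "Re (mtrace d Q) = d * x - s * Re (mtrace d W)"
    by (simp add: mtrace_def Q_def sum_subtractf sum_distrib_left)
  have "2 * real d * (t - p)\<^sup>2 \<le> real d * (p * ln y + (1 - p) * ln x)"
    using mult_left_mono[OF binary_pinsker[of p t], of "real d"] p by (simp add: x_def y_def mult_ac)
  \<comment> \<open>An upper bound on the trace suffices: since \<open>ln y < ln x\<close>, lowering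
    the trace of \<open>W\<close> only raises the right-hand side.\<close>
  also have "\<dots> \<le> Re (mtrace d W) * ln y + (d - Re (mtrace d W)) * ln x"
  proof -
    have "0 \<le> (p * d - Re (mtrace d W)) * (ln x - ln y)"
      using tr xy by (intro mult_nonneg_nonneg) auto
    then show ?thesis by (simp add: algebra_simps)
  qed
  also have "\<dots> = ((d * x - Re (mtrace d Q)) * ln y + (Re (mtrace d Q) - d * y) * ln x) / (x - y)"
  proof -
    have "y = x - s" using s by simp
    then have "Re (mtrace d Q) - d * y = s * (d - Re (mtrace d W))"
      by (simp only: trQ) (simp only: algebra_simps)
    moreover have "d * x - Re (mtrace d Q) = s * Re (mtrace d W)" by (simp add: trQ)
    ultimately show ?thesis using s(1)
      unfolding s(2) by (simp add: mult.assoc flip: distrib_left)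
  qed
  finally have "exp (2 * real d * (t - p)\<^sup>2) \<le> exp \<dots>" by simp
  also have "\<dots> \<le> ?D" by (rule det_ge_of_trace[OF xy Q])
  finally have D: "exp (2 * real d * (t - p)\<^sup>2) \<le> ?D" .
  let ?E = "{v \<in> space ?M. Re (qform d Q v) \<le> 1}"
  have [measurable]: "?E \<in> sets ?M" "?B \<in> sets ?M" by measurable
  have "{v \<in> space ?M. t * sqnorm {..<d} v \<le> Re (qform d W v)} \<in> sets ?M"
    by (intro borel_measurable_le borel_measurable_times borel_measurable_const measurable_sqnorm
        measurable_compose[OF measurable_qform borel_measurable_Re])
  then have [measurable]: "?C \<in> sets ?M" by (intro sets.sets_Collect_conj) auto
  have Dpos: "0 < ?D" and DE: "ennreal ?D * emeasure ?M ?E = emeasure ?M ?B"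
  proof -
    \<comment> \<open>The integral identity for the indicator of the half-line up to 1 is the volume
      formula: determinant times ellipsoid equals ball.\<close>
    have *: "0 < ?D \<and> ennreal ?D * (\<integral>\<^sup>+v. indicator {..1} (Re (qform d Q v)) \<partial>?M)
      = (\<integral>\<^sup>+v. indicator {..1} (sqnorm {..<d} v) \<partial>?M)"
      using Q by (intro nn_integral_qform[OF xy(1)]) auto
    then show "0 < ?D" by simp
    have "(\<integral>\<^sup>+v. indicator {..1} (Re (qform d Q v)) \<partial>?M) = (\<integral>\<^sup>+v. indicator ?E v \<partial>?M)"
      by (intro nn_integral_cong) (auto simp: indicator_def)
    moreover have "(\<integral>\<^sup>+v. indicator {..1} (sqnorm {..<d} v) \<partial>?M) = (\<integral>\<^sup>+v. indicator ?B v \<partial>?M)"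
      by (intro nn_integral_cong) (auto simp: indicator_def)
    ultimately show "ennreal ?D * emeasure ?M ?E = emeasure ?M ?B" using * by simp
  qed
  have mE: "?D * measure ?M ?E = measure ?M ?B"
    unfolding measure_def DE[symmetric] using Dpos by (simp add: enn2real_mult)
  have finB: "emeasure ?M ?B < \<infinity>" by (rule emeasure_unit_ball) simp
  have finE: "emeasure ?M ?E < \<infinity>"
    using finB Dpos unfolding DE[symmetric] by (auto simp: ennreal_mult_less_top)
  have "?C \<subseteq> ?E"
  proof
    fix v assume v: "v \<in> ?C"
    then have "s * (t * sqnorm {..<d} v) \<le> s * Re (qform d W v)" using s(1) by auto
    moreover have "x * sqnorm {..<d} v = sqnorm {..<d} v + s * (t * sqnorm {..<d} v)"
    proof -
      have "x = 1 + s * t" using s(3) by simp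
      then show ?thesis by (simp add: algebra_simps)
    qed
    ultimately show "v \<in> ?E" using v by (auto simp: Qf)
  qed
  then have "measure ?M ?C \<le> measure ?M ?E"
    using finE by (intro measure_mono_fmeasurable) (auto simp: fmeasurable_def)
  also have "\<dots> = measure ?M ?B / ?D" using mE Dpos by (simp add: field_simps)
  also have "\<dots> \<le> measure ?M ?B / exp (2 * real d * (t - p)\<^sup>2)"
    using D Dpos by (intro divide_left_mono) (auto intro: mult_pos_pos)
  also have "\<dots> = exp (- 2 * real d * (t - p)\<^sup>2) * measure ?M ?B"
    by (simp add: exp_minus field_simps)
  finally show ?thesis .
qed

section \<open>Covering numbers by volume comparison\<close>

text \<open>The inverse of \<open>z \<mapsto> t + r z\<close>, so that preimages under it are
  translated and dilated copies of a set. The restriction to \<open>I\<close> keeps its values in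
  the extensional function space that carries the product measure.\<close>

definition affine_pull :: "'i set \<Rightarrow> ('i \<Rightarrow> complex) \<Rightarrow> real \<Rightarrow> ('i \<Rightarrow> complex) \<Rightarrow> 'i \<Rightarrow> complex" where
  "affine_pull I t r z = (\<lambda>i\<in>I. (z i - t i) / of_real r)"

lemma emeasure_complex_affine:
  fixes t :: complex and r :: real
  assumes "0 < r" and A[measurable]: "A \<in> sets lborel"
  shows "emeasure lborel {z. (z - t) / of_real r \<in> A} = ennreal (r\<^sup>2) * emeasure lborel A"
proof -
  let ?S = "{z. (z - t) / of_real r \<in> A}"
  have [measurable]: "(\<lambda>z. (z - t) / of_real r) \<in> borel_measurable borel" by measurable
  have "?S = (\<lambda>z. (z - t) / of_real r) -` A \<inter> space borel" by auto
  also have "\<dots> \<in> sets borel" using A by (intro measurable_sets[where A = borel]) auto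
  finally have S[measurable]: "?S \<in> sets borel" .
  have "emeasure lborel ?S = (\<integral>\<^sup>+z. indicator ?S z \<partial>lborel)" by simp
  also have "\<dots> = ennreal (r\<^sup>2) * (\<integral>\<^sup>+z. indicator ?S (t + r *\<^sub>R z) \<partial>lborel)"
    using assms(1) by (intro nn_integral_complex_affine) auto
  also have "(\<lambda>z. indicator ?S (t + r *\<^sub>R z) :: ennreal) = indicator A"
    using assms(1) by (auto simp: indicator_def scaleR_conv_of_real fun_eq_iff)
  finally show ?thesis using A by (simp add: nn_integral_indicator)
qed

lemma measurable_affine_pull [measurable]: "affine_pull I t r \<in> cprod I \<rightarrow>\<^sub>M cprod I"
  unfolding affine_pull_def[abs_def]
proof (rule measurable_restrict)
  fix i assume "i \<in> I"
  then have "(\<lambda>z. z i) \<in> borel_measurable (cprod I)" by (rule measurable_component_lborel)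
  then have "(\<lambda>z. (z i - t i) / of_real r) \<in> borel_measurable (cprod I)"
    by (intro borel_measurable_divide borel_measurable_diff borel_measurable_const)
  then show "(\<lambda>z. (z i - t i) / of_real r) \<in> cprod I \<rightarrow>\<^sub>M lborel" by simp
qed

text \<open>The rescaled push-forward agrees with the product measure on boxes, hence everywhere.
  The exponent is the real dimension: each complex coordinate contributes
  \<open>r^2\<close>.\<close>

lemma emeasure_affine_pull:
  assumes I: "finite I" and r: "0 < r" and S: "S \<in> sets (cprod I)"
  shows "emeasure (cprod I) (affine_pull I t r -` S \<inter> space (cprod I))
    = ennreal (r ^ (2 * card I)) * emeasure (cprod I) S"
proof -
  interpret product_sigma_finite "\<lambda>_. lborel :: complex measure" by (rule product_sigma_finite_lborel)
  define P where "P = density (distr (cprod I) (cprod I) (affine_pull I t r)) (\<lambda>_. ennreal (inverse (r ^ (2 * card I))))"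
  have PS: "emeasure P S' = ennreal (inverse (r ^ (2 * card I))) * emeasure (cprod I) (affine_pull I t r -` S' \<inter> space (cprod I))"
    if "S' \<in> sets (cprod I)" for S'
    using that by (simp add: P_def emeasure_density nn_integral_cmult emeasure_distr)
  have "P = cprod I"
  proof (rule PiM_eqI[OF I])
    show "sets P = sets (cprod I)" by (simp add: P_def)
    fix A :: "'a \<Rightarrow> complex set" assume A: "\<And>i. i \<in> I \<Longrightarrow> A i \<in> sets lborel"
    let ?A = "\<lambda>i. {z. (z - t i) / of_real r \<in> A i}"
    have m: "?A i \<in> sets lborel" if "i \<in> I" for i
    proof -
      have "(\<lambda>z. (z - t i) / of_real r) \<in> borel_measurable borel" by measurable
      then have "(\<lambda>z. (z - t i) / of_real r) -` A i \<inter> space borel \<in> sets borel"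
        using A[OF that] by (intro measurable_sets) auto
      then show ?thesis by (simp add: vimage_def)
    qed
    have "affine_pull I t r -` PiE I A \<inter> space (cprod I) = PiE I ?A"
      by (auto simp: affine_pull_def space_PiM PiE_iff)
    then have "emeasure (cprod I) (affine_pull I t r -` PiE I A \<inter> space (cprod I))
        = (\<Prod>i\<in>I. ennreal (r\<^sup>2) * emeasure lborel (A i))"
      using I A m by (simp add: emeasure_PiM emeasure_complex_affine[OF r])
    also have "\<dots> = ennreal (r ^ (2 * card I)) * (\<Prod>i\<in>I. emeasure lborel (A i))"
      using r by (simp add: prod.distrib ennreal_power power_mult)
    finally show "emeasure P (PiE I A) = (\<Prod>i\<in>I. emeasure lborel (A i))"
      using I A r by (simp add: PS sets_PiM_I_finite mult.assoc[symmetric] ennreal_mult[symmetric])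
  qed
  then have "emeasure (cprod I) S = ennreal (inverse (r ^ (2 * card I))) *
      emeasure (cprod I) (affine_pull I t r -` S \<inter> space (cprod I))"
    using PS[OF S] by simp
  then show ?thesis using r by (simp add: mult.assoc[symmetric] ennreal_mult[symmetric])
qed

lemma borel_measurable_coord: "(\<lambda>v. v i) \<in> borel_measurable (cprod I)"
proof (cases "i \<in> I")
  case True
  then show ?thesis by (rule measurable_component_lborel)
next
  case False
  then have "v i = undefined" if "v \<in> space (cprod I)" for v
    using that unfolding space_PiM by (rule PiE_arb[rotated])
  then have "(\<lambda>v. v i) \<in> borel_measurable (cprod I) \<longleftrightarrow> (\<lambda>v. undefined :: complex) \<in> borel_measurable (cprod I)"
    by (rule measurable_cong)
  then show ?thesis by simp
qed

text \<open>For a countable index type the coordinates generate the Borel sets of the function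
  space. Closedness thus handles sets cut out by uncountably many conditions, such as
  \<open>body\<close> or the achievable states.\<close>

lemma sets_cprod_closed:
  fixes C :: "('i::countable \<Rightarrow> complex) set"
  assumes "closed C"
  shows "{v \<in> space (cprod I). v \<in> C} \<in> sets (cprod I)"
proof -
  have "(\<lambda>v. v) \<in> borel_measurable (cprod I)"
    by (rule measurable_coordinatewise_then_product) (rule borel_measurable_coord)
  then have "(\<lambda>v. v) -` C \<inter> space (cprod I) \<in> sets (cprod I)"
    using assms by (intro measurable_sets) auto
  moreover have "(\<lambda>v. v) -` C \<inter> space (cprod I) = {v \<in> space (cprod I). v \<in> C}" by auto
  ultimately show ?thesis by simp
qed

definition lin :: "'i set \<Rightarrow> ('i \<Rightarrow> complex) \<Rightarrow> ('i \<Rightarrow> complex) \<Rightarrow> complex" where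
  "lin I a x = (\<Sum>i\<in>I. a i * x i)"

text \<open>The functionals in \<open>A\<close> are what has to be controlled; the coordinate bounds only keep the
  volume finite, so their scale does not enter the covering number.\<close>

definition body :: "'i set \<Rightarrow> ('i \<Rightarrow> complex) set \<Rightarrow> real \<Rightarrow> ('i \<Rightarrow> complex) set" where
  "body I A r = {x \<in> space (cprod I). (\<forall>i\<in>I. cmod (x i) \<le> r) \<and> (\<forall>a\<in>A. cmod (lin I a x) \<le> r)}"

lemma lin_affine_pull: "lin I a (affine_pull I t r z) = (lin I a z - lin I a t) / of_real r"
proof -
  have "lin I a (affine_pull I t r z) = (\<Sum>i\<in>I. (a i * z i - a i * t i) / of_real r)"
    unfolding lin_def affine_pull_def by (intro sum.cong) (auto simp: right_diff_distrib)
  then show ?thesis by (simp add: lin_def sum_subtractf flip: sum_divide_distrib)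
qed

lemma continuous_on_apply [continuous_intros]:
  "continuous_on S f \<Longrightarrow> continuous_on S (\<lambda>x. (f x :: 'i \<Rightarrow> 'b::topological_space) i)"
  by (rule continuous_on_product_then_coordinatewise)

lemma sets_body:
  fixes I :: "'i::countable set"
  shows "body I A r \<in> sets (cprod I)"
proof -
  have "closed {x::'i \<Rightarrow> complex. (\<forall>i\<in>I. cmod (x i) \<le> r) \<and> (\<forall>a\<in>A. cmod (lin I a x) \<le> r)}"
    unfolding lin_def Ball_def
    by (intro closed_Collect_conj closed_Collect_all closed_Collect_imp closed_Collect_le open_Collect_const continuous_intros)
  from sets_cprod_closed[OF this, of I] show ?thesis by (simp add: body_def)
qed

text \<open>Positive and finite volume is all that the packing argument takes from the body, so the
  crude bound \<open>b\<close>, which only serves to fit a small polydisc inside, never reaches the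
  cardinality estimate.\<close>

lemma emeasure_body:
  fixes I :: "'i::countable set"
  assumes I: "finite I" and b: "\<forall>a\<in>A. \<forall>i\<in>I. cmod (a i) \<le> b"
  shows "0 < emeasure (cprod I) (body I A 1)" "emeasure (cprod I) (body I A 1) < \<infinity>"
proof -
  define s where "s = 1 / (1 + card I * \<bar>b\<bar>)"
  have pos: "0 < 1 + card I * \<bar>b\<bar>" by (simp add: add_pos_nonneg)
  then have s: "0 < s" "s \<le> 1" unfolding s_def by (auto simp: divide_simps)
  have "PiE I (\<lambda>_. cball 0 s) \<subseteq> body I A 1"
  proof
    fix x assume x: "x \<in> PiE I (\<lambda>_. cball (0::complex) s)"
    then have xi: "cmod (x i) \<le> s" if "i \<in> I" for i using that by auto
    have "cmod (lin I a x) \<le> 1" if "a \<in> A" for a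
    proof -
      have "cmod (lin I a x) \<le> (\<Sum>i\<in>I. cmod (a i) * cmod (x i))"
        unfolding lin_def by (rule order_trans[OF norm_sum]) (simp add: norm_mult)
      also have "\<dots> \<le> (\<Sum>i\<in>I. \<bar>b\<bar> * s)"
      proof (intro sum_mono mult_mono)
        fix i assume "i \<in> I"
        then show "cmod (a i) \<le> \<bar>b\<bar>" using b that abs_ge_self order_trans by blast
      qed (use xi in auto)
      also have "\<dots> \<le> 1" using pos by (simp add: s_def divide_simps)
      finally show ?thesis .
    qed
    moreover have "\<forall>i\<in>I. cmod (x i) \<le> 1" using xi s(2) by force
    moreover have "x \<in> space (cprod I)" using x by (auto simp: space_PiM)
    ultimately show "x \<in> body I A 1" by (simp add: body_def)
  qed
  then have "emeasure (cprod I) (PiE I (\<lambda>_. cball 0 s)) \<le> emeasure (cprod I) (body I A 1)"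
    by (intro emeasure_mono sets_body)
  then show "0 < emeasure (cprod I) (body I A 1)"
    using emeasure_polydisc(1)[OF I s(1)] by (rule less_le_trans[rotated])
  have "body I A 1 \<subseteq> PiE I (\<lambda>_. cball 0 1)"
    by (auto simp: body_def space_PiM)
  then have "emeasure (cprod I) (body I A 1) \<le> emeasure (cprod I) (PiE I (\<lambda>_. cball 0 1))"
    using emeasure_polydisc(3)[OF I, of 1] by (intro emeasure_mono) auto
  then show "emeasure (cprod I) (body I A 1) < \<infinity>"
    using emeasure_polydisc(2)[OF I, of 1] by (simp add: le_less_trans)
qed

lemma affine_pull_in_body:
  assumes "0 < r"
  shows "affine_pull I t r z \<in> body I A 1 \<longleftrightarrow>
    (\<forall>i\<in>I. cmod (z i - t i) \<le> r) \<and> (\<forall>a\<in>A. cmod (lin I a z - lin I a t) \<le> r)"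
proof -
  have "affine_pull I t r z \<in> space (cprod I)" by (simp add: affine_pull_def space_PiM)
  moreover have "cmod (w / of_real r) \<le> 1 \<longleftrightarrow> cmod w \<le> r" for w
    using assms by (simp add: norm_divide)
  ultimately show ?thesis
    unfolding body_def by (simp add: lin_affine_pull) (simp add: affine_pull_def)
qed

text \<open>Copies of the body scaled by \<open>e/2\<close> around the points are disjoint and lie
  in the body scaled by \<open>1 + e/2\<close>. Volumes scale with the real dimension
  \<open>2 * card I\<close>, and the volume of the body itself cancels.\<close>

lemma card_separated_le:
  fixes I :: "'i::countable set"
  assumes I: "finite I" and b: "\<forall>a\<in>A. \<forall>i\<in>I. cmod (a i) \<le> b"
    and e: "0 < e" and N: "finite N" "N \<subseteq> body I A 1"
    and sep: "\<And>x y. x \<in> N \<Longrightarrow> y \<in> N \<Longrightarrow> x \<noteq> y \<Longrightarrow>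
      (\<exists>i\<in>I. e < cmod (x i - y i)) \<or> (\<exists>a\<in>A. e < cmod (lin I a x - lin I a y))"
  shows "real (card N) \<le> (1 + 2 / e) ^ (2 * card I)"
proof -
  let ?V = "emeasure (cprod I) (body I A 1)"
  let ?T = "\<lambda>t r. affine_pull I t r -` body I A 1 \<inter> space (cprod I)"
  note V = emeasure_body[OF I b]
  have mT: "?T t r \<in> sets (cprod I)" for t r
    by (intro measurable_sets[OF measurable_affine_pull] sets_body)
  have eT: "emeasure (cprod I) (?T t r) = ennreal (r ^ (2 * card I)) * ?V" if "0 < r" for t r
    using emeasure_affine_pull[OF I that sets_body] .
  have e2: "0 < e / 2" "0 < 1 + e / 2" using e by auto
  have disj: "disjoint_family_on (\<lambda>x. ?T x (e / 2)) N"
  proof (unfold disjoint_family_on_def, intro ballI impI, rule ccontr)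
    fix x y assume xy: "x \<in> N" "y \<in> N" "x \<noteq> y" and "?T x (e/2) \<inter> ?T y (e/2) \<noteq> {}"
    then obtain z where "z \<in> ?T x (e/2)" "z \<in> ?T y (e/2)" by auto
    then have z: "\<forall>i\<in>I. cmod (z i - x i) \<le> e/2" "\<forall>a\<in>A. cmod (lin I a z - lin I a x) \<le> e/2"
       "\<forall>i\<in>I. cmod (z i - y i) \<le> e/2" "\<forall>a\<in>A. cmod (lin I a z - lin I a y) \<le> e/2"
      by (simp_all add: affine_pull_in_body[OF e2(1)])
    have tri: "cmod (u - w) \<le> e" if "cmod (s - u) \<le> e/2" "cmod (s - w) \<le> e/2" for u w s
      using norm_triangle_ineq4[of "s - w" "s - u"] that by simp
    show False using sep[OF xy] z tri by (meson not_less)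
  qed
  have sub: "(\<Union>x\<in>N. ?T x (e / 2)) \<subseteq> ?T (\<lambda>_. 0) (1 + e / 2)"
  proof
    fix z assume "z \<in> (\<Union>x\<in>N. ?T x (e / 2))"
    then obtain x where x: "x \<in> N" "z \<in> ?T x (e/2)" by auto
    then have z: "\<forall>i\<in>I. cmod (z i - x i) \<le> e/2" "\<forall>a\<in>A. cmod (lin I a z - lin I a x) \<le> e/2"
      by (simp_all add: affine_pull_in_body[OF e2(1)])
    have xb: "\<forall>i\<in>I. cmod (x i) \<le> 1" "\<forall>a\<in>A. cmod (lin I a x) \<le> 1"
      using x(1) N(2) by (auto simp: body_def)
    have tri: "cmod s \<le> 1 + e/2" if "cmod (s - u) \<le> e/2" "cmod u \<le> 1" for u s
      using norm_triangle_ineq[of u "s - u"] that by simp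
    have "\<forall>i\<in>I. cmod (z i) \<le> 1 + e/2" using z(1) xb(1) tri by blast
    moreover have "\<forall>a\<in>A. cmod (lin I a z) \<le> 1 + e/2" using z(2) xb(2) tri by blast
    moreover have "lin I a (\<lambda>_. 0) = 0" for a by (simp add: lin_def)
    ultimately show "z \<in> ?T (\<lambda>_. 0) (1 + e/2)"
      using x(2) affine_pull_in_body[OF e2(2), of I "\<lambda>_. 0" z A] by simp
  qed
  have "ennreal (card N * (e/2) ^ (2 * card I)) * ?V = (\<Sum>x\<in>N. emeasure (cprod I) (?T x (e / 2)))"
    using eT[OF e2(1)] e by (simp add: ennreal_mult ennreal_of_nat_eq_real_of_nat mult.assoc)
  also have "\<dots> = emeasure (cprod I) (\<Union>x\<in>N. ?T x (e / 2))"
    using disj mT N(1) by (intro sum_emeasure) auto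
  also have "\<dots> \<le> emeasure (cprod I) (?T (\<lambda>_. 0) (1 + e / 2))"
    using sub mT by (intro emeasure_mono)
  also have "\<dots> = ennreal ((1 + e/2) ^ (2 * card I)) * ?V" by (rule eT[OF e2(2)])
  finally have "ennreal (card N * (e/2) ^ (2 * card I)) * ?V \<le> ennreal ((1 + e/2) ^ (2 * card I)) * ?V" .
  then have "ennreal (card N * (e/2) ^ (2 * card I)) \<le> ennreal ((1 + e/2) ^ (2 * card I))"
    using V by (simp add: ennreal_mult_le_mult_iff mult.commute[of _ ?V])
  then have "card N * (e/2) ^ (2 * card I) \<le> (1 + e/2) ^ (2 * card I)"
    using e by (subst (asm) ennreal_le_iff) auto
  then have "card N \<le> (1 + e/2) ^ (2 * card I) / (e/2) ^ (2 * card I)"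
    using e2 by (simp add: pos_le_divide_eq)
  also have "\<dots> = (1 + 2 / e) ^ (2 * card I)"
    using e by (simp add: power_divide[symmetric] add_divide_distrib add.commute)
  finally show ?thesis .
qed

text \<open>A separated set of largest cardinality is a net, since a point far from all its members
  could be added. The net lies inside \<open>K\<close>, which later ensures that its members are
  channels.\<close>

lemma covering_number:
  fixes I :: "'i::countable set"
  assumes I: "finite I" and b: "\<forall>a\<in>A. \<forall>i\<in>I. cmod (a i) \<le> b"
    and e: "0 < e" and K: "K \<subseteq> body I A 1"
  obtains N where "finite N" "N \<subseteq> K" "real (card N) \<le> (1 + 2 / e) ^ (2 * card I)"
    "\<And>x. x \<in> K \<Longrightarrow> \<exists>y\<in>N. \<forall>a\<in>A. cmod (lin I a x - lin I a y) \<le> e"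
proof -
  define far where "far = (\<lambda>x y. (\<exists>i\<in>I. e < cmod (x i - y i)) \<or> (\<exists>a\<in>A. e < cmod (lin I a x - lin I a y)))"
  define sepd where "sepd = (\<lambda>N. finite N \<and> N \<subseteq> K \<and> (\<forall>x\<in>N. \<forall>y\<in>N. x \<noteq> y \<longrightarrow> far x y))"
  have bound: "real (card N) \<le> (1 + 2 / e) ^ (2 * card I)" if "sepd N" for N
    using that K by (intro card_separated_le[OF I b e]) (auto simp: sepd_def far_def)
  have "sepd {}" by (simp add: sepd_def)
  moreover have "\<forall>N. sepd N \<longrightarrow> card N < Suc (nat \<lfloor>(1 + 2 / e) ^ (2 * card I)\<rfloor>)"
    using bound by (auto simp: less_Suc_eq_le le_nat_floor)
  ultimately obtain N where N: "sepd N" "\<And>N'. sepd N' \<Longrightarrow> card N' \<le> card N"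
    using ex_has_greatest_nat[of sepd "{}" card] by blast
  have far_sym: "far x y \<longleftrightarrow> far y x" for x y unfolding far_def by (simp add: norm_minus_commute)
  show thesis
  proof (rule that[of N])
    show "finite N" "N \<subseteq> K" using N(1) by (auto simp: sepd_def)
    show "real (card N) \<le> (1 + 2 / e) ^ (2 * card I)" using bound N(1) .
    fix x assume x: "x \<in> K"
    have "\<exists>y\<in>N. \<not> far x y"
    proof (cases "x \<in> N")
      case True
      have "\<not> far x x" using e by (simp add: far_def)
      then show ?thesis using True by blast
    next
      case False
      show ?thesis
      proof (rule ccontr)
        assume "\<not> (\<exists>y\<in>N. \<not> far x y)"
        then have "sepd (insert x N)" using N(1) x far_sym unfolding sepd_def by blast
        then have "card (insert x N) \<le> card N" by (rule N(2))
        then show False using False N(1) by (simp add: sepd_def)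
      qed
    qed
    then show "\<exists>y\<in>N. \<forall>a\<in>A. cmod (lin I a x - lin I a y) \<le> e"
      unfolding far_def by (meson not_less)
  qed
qed

section \<open>Positive semidefinite matrices\<close>

lemma psd_qformD:
  assumes "psd n X"
  shows "Im (qform n X v) = 0" "0 \<le> Re (qform n X v)"
  using assms by (auto simp: psd_qform)

lemma psd_hermitian: "psd n X \<Longrightarrow> i < n \<Longrightarrow> j < n \<Longrightarrow> X j i = cnj (X i j)"
  using hermitian_of_real_qform[of n X i j] psd_qformD by blast

lemma psd_diag:
  assumes "psd n X" "i < n"
  shows "Im (X i i) = 0" "0 \<le> Re (X i i)"
  using psd_qformD[OF assms(1)] qform_single[OF assms(2), of X] by metis+

lemma psd_cong:
  assumes "\<And>i j. i < n \<Longrightarrow> j < n \<Longrightarrow> X i j = Y i j"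
  shows "psd n X \<longleftrightarrow> psd n Y"
proof -
  have "qform n X v = qform n Y v" for v
    unfolding qform_def using assms by (intro sum.cong) auto
  then show ?thesis by (simp add: psd_qform)
qed

lemma psd_cauchy_schwarz:
  assumes X: "psd n X" and ij: "i < n" "j < n"
  shows "(cmod (X i j))\<^sup>2 \<le> Re (X i i) * Re (X j j)"
proof (cases "i = j")
  case True
  then have "X i j = of_real (Re (X i i))" using psd_diag[OF X ij(1)] by (simp add: complex_eq_iff)
  then show ?thesis using True psd_diag[OF X ij(1)]
    by (metis norm_of_real order_refl power2_abs power2_eq_square)
next
  case False
  \<comment> \<open>A phase that turns the off-diagonal entry into minus its modulus, the worst case
    for the two-dimensional test vectors.\<close>
  define z where "z = (if X i j = 0 then 1 else - cnj (X i j) / of_real (cmod (X i j)))"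
  have z: "cmod z = 1" by (simp add: z_def norm_divide)
  have zX: "z * X i j = - of_real (cmod (X i j))"
  proof (cases "X i j = 0")
    case False
    have "cnj (X i j) * X i j = of_real (cmod (X i j)) * of_real (cmod (X i j))"
      by (metis complex_norm_square mult.commute of_real_power power2_eq_square)
    then show ?thesis using False by (simp add: z_def)
  qed simp
  have main: "0 \<le> x\<^sup>2 * Re (X i i) + y\<^sup>2 * Re (X j j) - 2 * x * y * cmod (X i j)" for x y :: real
  proof -
    let ?s = "of_real x :: complex" and ?t = "of_real y * z"
    have form: "0 \<le> Re (cnj ?s * X i i * ?s + cnj ?s * X i j * ?t + cnj ?t * X j i * ?s + cnj ?t * X j j * ?t)"
      using psd_qformD(2)[OF X, of "\<lambda>k. if k = i then ?s else if k = j then ?t else 0"]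
      unfolding qform_two[OF ij False] .
    have "cnj ?s * X i j * ?t = of_real x * of_real y * (z * X i j)" by (simp add: mult_ac)
    then have 1: "cnj ?s * X i j * ?t = of_real (- (x * y * cmod (X i j)))" by (simp add: zX)
    have "cnj ?t * X j i * ?s = cnj (cnj ?s * X i j * ?t)"
      using psd_hermitian[OF X ij] by (simp add: mult_ac)
    then have 2: "cnj ?t * X j i * ?s = of_real (- (x * y * cmod (X i j)))"
      unfolding 1 by simp
    have "cnj z * z = 1" using z by (metis complex_norm_square mult.commute of_real_1 one_power2)
    then have "(of_real y * of_real y) * (cnj z * z) * X j j = of_real (y\<^sup>2) * X j j"
      by (simp add: power2_eq_square)
    then have 3: "cnj ?t * X j j * ?t = of_real (y\<^sup>2) * X j j" by (simp add: mult_ac)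
    have 4: "cnj ?s * X i i * ?s = of_real (x\<^sup>2) * X i i" by (simp add: power2_eq_square mult_ac)
    show ?thesis using form unfolding 1 2 3 4 by (simp del: of_real_power)
  qed
  let ?a = "Re (X i i)" and ?b = "Re (X j j)" and ?c = "cmod (X i j)"
  have ab: "0 \<le> ?a" "0 \<le> ?b" using psd_diag[OF X] ij by auto
  show ?thesis
  proof (cases "?b = 0")
    case True
    \<comment> \<open>When the second diagonal entry is 0, \<open>main\<close> is affine in
      \<open>y\<close>, and a positive \<open>?c\<close> would make it negative for large
      \<open>y\<close>.\<close>
    have "?c = 0"
    proof (rule ccontr)
      assume "?c \<noteq> 0"
      then show False using main[of 1 "(?a + 1) / ?c"] True ab by simp
    qed
    then show ?thesis using ab by simp
  next
    case False
    then have "0 < ?b" using ab by simp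
    moreover have "0 \<le> ?b * (?a * ?b - ?c\<^sup>2)"
      using main[of ?b ?c] by (simp add: power2_eq_square algebra_simps)
    ultimately show ?thesis by (simp add: zero_le_mult_iff)
  qed
qed

lemma sum_fibre:
  fixes n :: nat
  assumes "finite S" "\<And>x. x \<in> S \<Longrightarrow> f x < n"
  shows "(\<Sum>a<n. g a * (\<Sum>x\<in>{x\<in>S. f x = a}. h x)) = (\<Sum>x\<in>S. g (f x) * h x :: complex)"
proof -
  have "(\<Sum>a<n. g a * (\<Sum>x\<in>{x\<in>S. f x = a}. h x)) = (\<Sum>a<n. \<Sum>x\<in>{x\<in>S. f x = a}. g (f x) * h x)"
    by (intro sum.cong) (auto simp: sum_distrib_left)
  also have "\<dots> = (\<Sum>x\<in>S. g (f x) * h x)" using assms by (intro sum.group) auto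
  finally show ?thesis .
qed

text \<open>The form at \<open>v\<close> equals the form of \<open>X\<close> at the push-forward of
  \<open>v\<close>, which sums \<open>v\<close> over the fibres of \<open>f\<close>; hence
  \<open>f\<close> may be any map. Swapping tensor factors and compressing to selected basis vectors
  are both of this kind.\<close>

lemma psd_reindex:
  assumes "psd n X" "\<And>i. i < n' \<Longrightarrow> f i < n"
  shows "psd n' (\<lambda>i j. X (f i) (f j))"
proof -
  have "\<exists>w. qform n' (\<lambda>i j. X (f i) (f j)) v = qform n X w" for v
  proof -
    define w where "w = (\<lambda>a. \<Sum>i\<in>{i\<in>{..<n'}. f i = a}. v i)"
    have cw: "cnj (w a) = (\<Sum>i\<in>{i\<in>{..<n'}. f i = a}. cnj (v i))" for a by (simp add: w_def)
    have "qform n X w = (\<Sum>a<n. (\<Sum>b<n. X a b * w b) * cnj (w a))"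
      by (simp add: qform_def sum_distrib_left mult_ac)
    also have "\<dots> = (\<Sum>i<n'. (\<Sum>b<n. X (f i) b * w b) * cnj (v i))"
      unfolding cw using assms(2) by (intro sum_fibre) auto
    also have "\<dots> = (\<Sum>i<n'. (\<Sum>j<n'. X (f i) (f j) * v j) * cnj (v i))"
      unfolding w_def using assms(2) by (intro sum.cong refl arg_cong2[where f = "(*)"] sum_fibre) auto
    also have "\<dots> = qform n' (\<lambda>i j. X (f i) (f j)) v"
      by (simp add: qform_def sum_distrib_left mult_ac)
    finally show ?thesis by metis
  qed
  then show ?thesis using assms(1) unfolding psd_qform by metis
qed

lemma qform_sum: "qform n (\<lambda>i j. \<Sum>e\<in>S. X e i j) v = (\<Sum>e\<in>S. qform n (X e) v)"
proof -
  have "qform n (\<lambda>i j. \<Sum>e\<in>S. X e i j) v = (\<Sum>i<n. \<Sum>e\<in>S. \<Sum>j<n. cnj (v i) * X e i j * v j)"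
    unfolding qform_def sum_distrib_left sum_distrib_right by (intro sum.cong refl sum.swap)
  also have "\<dots> = (\<Sum>e\<in>S. qform n (X e) v)" unfolding qform_def by (rule sum.swap)
  finally show ?thesis .
qed

lemma psd_sum: "(\<And>e. e \<in> S \<Longrightarrow> psd n (X e)) \<Longrightarrow> psd n (\<lambda>i j. \<Sum>e\<in>S. X e i j)"
  unfolding psd_qform qform_sum by (auto intro: sum_nonneg)

lemma sum_divmod: "(\<Sum>u<p * k. f u) = (\<Sum>a<p. \<Sum>s<k. f (a * k + s :: nat))"
proof -
  have "(\<Sum>u<p * k. f u) = (\<Sum>a<p. sum f {a * k ..< a * k + k})" by (rule sum.nat_group[symmetric])
  moreover have "sum f {a * k ..< a * k + k} = (\<Sum>s<k. f (a * k + s))" for a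
    using sum.shift_bounds_nat_ivl[of f 0 "a * k" k] by (simp add: lessThan_atLeast0 add.commute)
  ultimately show ?thesis by simp
qed

lemma less_mult_divmod: "a < p \<Longrightarrow> s < k \<Longrightarrow> a * k + s < p * (k::nat)"
  using mult_le_mono1[of "Suc a" p k] by simp

lemma psd_block_sum:
  assumes "psd (E * k) X"
  shows "psd E (\<lambda>e e'. \<Sum>r<k. \<Sum>r'<k. X (e * k + r) (e' * k + r'))"
proof -
  have "qform E (\<lambda>e e'. \<Sum>r<k. \<Sum>r'<k. X (e * k + r) (e' * k + r')) v = qform (E * k) X (\<lambda>u. v (u div k))" for v
  proof -
    have "qform (E * k) X (\<lambda>u. v (u div k)) = (\<Sum>e<E. \<Sum>r<k. \<Sum>e'<E. \<Sum>r'<k. cnj (v e) * X (e * k + r) (e' * k + r') * v e')"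
      unfolding qform_def sum_divmod by (intro sum.cong refl) simp
    also have "\<dots> = (\<Sum>e<E. \<Sum>e'<E. \<Sum>r<k. \<Sum>r'<k. cnj (v e) * X (e * k + r) (e' * k + r') * v e')"
      by (intro sum.cong[OF refl], rule sum.swap)
    finally show ?thesis by (simp add: qform_def sum_distrib_left sum_distrib_right)
  qed
  then show ?thesis using assms by (simp add: psd_qform)
qed

text \<open>Each entry has modulus at most the geometric, hence the arithmetic, mean of its two
  diagonal entries. This is how overlaps with EPR vectors, whose coefficients are all equal, are
  compared with traces.\<close>

lemma psd_sum_le_trace:
  assumes "psd n X"
  shows "Re (\<Sum>i<n. \<Sum>j<n. X i j) \<le> n * Re (mtrace n X)"
proof -
  have "Re (X i j) \<le> (Re (X i i) + Re (X j j)) / 2" if "i < n" "j < n" for i j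
  proof -
    have "(Re (X i j))\<^sup>2 \<le> (cmod (X i j))\<^sup>2" by (simp add: abs_Re_le_cmod power2_le_iff_abs_le)
    also have "\<dots> \<le> Re (X i i) * Re (X j j)" by (rule psd_cauchy_schwarz[OF assms that])
    also have "\<dots> \<le> ((Re (X i i) + Re (X j j)) / 2)\<^sup>2"
      using zero_le_power2[of "Re (X i i) - Re (X j j)"] by (simp add: power2_eq_square algebra_simps)
    finally show ?thesis using psd_diag[OF assms] that by (intro power2_le_imp_le[of "Re (X i j)"]) auto
  qed
  then have "(\<Sum>i<n. \<Sum>j<n. Re (X i j)) \<le> (\<Sum>i<n. \<Sum>j<n. (Re (X i i) + Re (X j j)) / 2)"
    by (intro sum_mono) auto
  also have "\<dots> = n * (\<Sum>i<n. Re (X i i))"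
    by (simp add: sum.distrib add_divide_distrib sum_divide_distrib[symmetric] sum_distrib_left[symmetric])
  finally show ?thesis by (simp add: mtrace_def)
qed

text \<open>The sum is the trace of \<open>S\<close> times the transpose of \<open>T\<close>.
  Entries are bounded by the roots of diagonal products, which factorises the sum into a square, and
  Cauchy-Schwarz finishes. Its purpose is the trace of \<open>W\<close>, with the images of the
  identity under the two channels as \<open>S\<close> and \<open>T\<close>.\<close>

lemma psd_frobenius_le:
  assumes S: "psd n S" and T: "psd n T"
  shows "cmod (\<Sum>i<n. \<Sum>j<n. S i j * T i j) \<le> Re (mtrace n S) * Re (mtrace n T)"
proof -
  define s where "s = (\<lambda>i. sqrt (Re (S i i)))"
  define t where "t = (\<lambda>i. sqrt (Re (T i i)))"
  have le: "cmod (X i j) \<le> sqrt (Re (X i i)) * sqrt (Re (X j j))" if "psd n X" "i < n" "j < n" for X i j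
    using psd_cauchy_schwarz[OF that] by (simp add: real_le_rsqrt flip: real_sqrt_mult)
  have "cmod (\<Sum>i<n. \<Sum>j<n. S i j * T i j) \<le> (\<Sum>i<n. \<Sum>j<n. cmod (S i j) * cmod (T i j))"
    by (rule order_trans[OF norm_sum] sum_mono order_trans[OF norm_sum])+ (simp add: norm_mult)
  also have "\<dots> \<le> (\<Sum>i<n. \<Sum>j<n. (s i * s j) * (t i * t j))"
    unfolding s_def t_def using le[OF S] le[OF T] psd_diag[OF S]
    by (intro sum_mono mult_mono) auto
  also have "\<dots> = (\<Sum>i<n. s i * t i)\<^sup>2" by (simp add: power2_eq_square sum_product mult_ac)
  also have "\<dots> \<le> (\<Sum>i<n. (s i)\<^sup>2) * (\<Sum>i<n. (t i)\<^sup>2)" by (rule Cauchy_Schwarz_ineq_sum)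
  also have "\<dots> = Re (mtrace n S) * Re (mtrace n T)"
    using psd_diag[OF S] psd_diag[OF T] by (simp add: s_def t_def mtrace_def)
  finally show ?thesis .
qed

section \<open>Channels and their overlap with EPR pairs\<close>

lemma sum_swap_pairs:
  "(\<Sum>b\<in>B. \<Sum>b'\<in>B'. \<Sum>a\<in>A. \<Sum>a'\<in>A'. f a a' b b') = (\<Sum>a\<in>A. \<Sum>a'\<in>A'. \<Sum>b\<in>B. \<Sum>b'\<in>B'. f a a' b b')"
proof -
  have "(\<Sum>b\<in>B. \<Sum>b'\<in>B'. \<Sum>a\<in>A. \<Sum>a'\<in>A'. f a a' b b') = (\<Sum>b\<in>B. \<Sum>a\<in>A. \<Sum>b'\<in>B'. \<Sum>a'\<in>A'. f a a' b b')"
    by (rule sum.cong[OF refl], rule sum.swap)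
  also have "\<dots> = (\<Sum>a\<in>A. \<Sum>b\<in>B. \<Sum>b'\<in>B'. \<Sum>a'\<in>A'. f a a' b b')" by (rule sum.swap)
  also have "\<dots> = (\<Sum>a\<in>A. \<Sum>b\<in>B. \<Sum>a'\<in>A'. \<Sum>b'\<in>B'. f a a' b b')"
    by (rule sum.cong[OF refl], rule sum.cong[OF refl], rule sum.swap)
  also have "\<dots> = (\<Sum>a\<in>A. \<Sum>a'\<in>A'. \<Sum>b\<in>B. \<Sum>b'\<in>B'. f a a' b b')"
    by (rule sum.cong[OF refl], rule sum.swap)
  finally show ?thesis .
qed

lemma channelD:
  assumes "channel p q Phi"
  shows "(\<And>i j. i < p \<Longrightarrow> j < p \<Longrightarrow> X i j = Y i j) \<Longrightarrow> r < q \<Longrightarrow> s < q \<Longrightarrow> Phi X r s = Phi Y r s"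
    and "r < q \<Longrightarrow> s < q \<Longrightarrow> Phi (\<lambda>i j. a * X i j + Y i j) r s = a * Phi X r s + Phi Y r s"
    and "mtrace q (Phi X) = mtrace p X"
    and "1 \<le> k \<Longrightarrow> psd (p * k) X \<Longrightarrow> psd (q * k) (ampl k Phi X)"
  using assms unfolding channel_def by blast+

lemma channel_sum:
  assumes ch: "channel p q Phi" and rs: "r < q" "s < q" and "finite S"
  shows "Phi (\<lambda>i j. \<Sum>k\<in>S. c k * G k i j) r s = (\<Sum>k\<in>S. c k * Phi (G k) r s)"
  using \<open>finite S\<close>
proof induction
  case empty
  \<comment> \<open>The definition offers linearity only in the shape \<open>a X + Y\<close>; the
    scalar -1 with \<open>X = Y = 0\<close> forces the image of the zero matrix to vanish.\<close>
  have "Phi (\<lambda>i j. (-1) * (\<lambda>_ _. 0) i j + (\<lambda>_ _. 0) i j) r s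
      = (-1) * Phi (\<lambda>_ _. 0) r s + Phi (\<lambda>_ _. 0) r s"
    by (rule channelD(2)[OF ch rs])
  then show ?case by simp
next
  case (insert k S)
  have "Phi (\<lambda>i j. c k * G k i j + (\<lambda>i j. \<Sum>k\<in>S. c k * G k i j) i j) r s
      = c k * Phi (G k) r s + Phi (\<lambda>i j. \<Sum>k\<in>S. c k * G k i j) r s"
    by (rule channelD(2)[OF ch rs])
  then show ?case using insert by simp
qed

lemma channel_expand:
  assumes ch: "channel p q Phi" and rs: "r < q" "s < q"
  shows "Phi X r s = (\<Sum>a<p. \<Sum>b<p. X a b * Phi (unitm a b) r s)"
proof -
  have "Phi X r s = Phi (\<lambda>i j. \<Sum>(a,b)\<in>{..<p}\<times>{..<p}. X a b * unitm a b i j) r s"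
  proof (rule channelD(1)[OF ch _ rs])
    fix i j assume ij: "i < p" "j < p"
    have "(\<Sum>(a,b)\<in>{..<p}\<times>{..<p}. X a b * unitm a b i j)
        = (\<Sum>x\<in>{..<p}\<times>{..<p}. if x = (i, j) then X i j else 0)"
      by (intro sum.cong) (auto simp: unitm_def split: if_splits)
    then show "X i j = (\<Sum>(a,b)\<in>{..<p}\<times>{..<p}. X a b * unitm a b i j)" using ij by simp
  qed
  also have "\<dots> = (\<Sum>(a,b)\<in>{..<p}\<times>{..<p}. X a b * Phi (unitm a b) r s)"
    using channel_sum[OF ch rs, of "{..<p}\<times>{..<p}" "\<lambda>(a,b). X a b" "\<lambda>(a,b). unitm a b"]
    by (simp add: case_prod_unfold)
  also have "\<dots> = (\<Sum>a<p. \<Sum>b<p. X a b * Phi (unitm a b) r s)" by (simp add: sum.cartesian_product)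
  finally show ?thesis .
qed

lemma mtrace_unitm: "a < p \<Longrightarrow> mtrace p (unitm a b) = (if a = b then 1 else 0)"
proof -
  assume "a < p"
  have "mtrace p (unitm a b) = (\<Sum>i<p. if i = a then (if a = b then 1 else 0) else 0)"
    unfolding mtrace_def unitm_def by (intro sum.cong) auto
  then show ?thesis using \<open>a < p\<close> by simp
qed

lemma channel_psd: "channel p q Phi \<Longrightarrow> psd p X \<Longrightarrow> psd q (Phi X)"
  using channelD(4)[of p q Phi 1 X] by (simp add: ampl_def)

lemma lo_apply_tensor:
  assumes A: "channel dA qA PhiA" and B: "channel dB qB PhiB"
    and r: "r < qA" "r' < qA" and s: "s < qB" "s' < qB"
  shows "lo_apply dA dB qB PhiA PhiB rho (r * qB + s) (r' * qB + s')
    = PhiB (\<lambda>b b'. PhiA (\<lambda>a a'. rho (a * dB + b) (a' * dB + b')) r r') s s'"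
proof -
  have expA: "PhiA (\<lambda>a a'. rho (a * dB + b) (a' * dB + b')) r r'
      = (\<Sum>a<dA. \<Sum>a'<dA. rho (a * dB + b) (a' * dB + b') * PhiA (unitm a a') r r')" for b b'
    by (rule channel_expand[OF A r])
  have "PhiB (\<lambda>b b'. PhiA (\<lambda>a a'. rho (a * dB + b) (a' * dB + b')) r r') s s'
    = (\<Sum>b<dB. \<Sum>b'<dB. (\<Sum>a<dA. \<Sum>a'<dA. rho (a * dB + b) (a' * dB + b') * PhiA (unitm a a') r r') * PhiB (unitm b b') s s')"
    by (subst channel_expand[OF B s]) (simp only: expA)
  also have "\<dots> = (\<Sum>b<dB. \<Sum>b'<dB. \<Sum>a<dA. \<Sum>a'<dA.
      rho (a * dB + b) (a' * dB + b') * PhiA (unitm a a') r r' * PhiB (unitm b b') s s')"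
    by (simp only: sum_distrib_right)
  also have "\<dots> = (\<Sum>a<dA. \<Sum>a'<dA. \<Sum>b<dB. \<Sum>b'<dB.
      rho (a * dB + b) (a' * dB + b') * PhiA (unitm a a') r r' * PhiB (unitm b b') s s')"
    by (rule sum_swap_pairs)
  also have "\<dots> = lo_apply dA dB qB PhiA PhiB rho (r * qB + s) (r' * qB + s')"
    using s by (simp add: lo_apply_def)
  finally show ?thesis ..
qed

lemma psd_swap:
  assumes "psd (p * k) X"
  shows "psd (k * p) (\<lambda>u w. X ((u mod p) * k + u div p) ((w mod p) * k + w div p))"
proof (rule psd_reindex[OF assms])
  fix u assume "u < k * p"
  then have "0 < p" "u div p < k" by (auto simp: less_mult_imp_div_less intro: gr0I)
  then show "u mod p * k + u div p < p * k" by (intro less_mult_divmod) auto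
qed

text \<open>Complete positivity is formulated with the ancilla as second factor. The product channel
  is therefore built as: act on A, swap the factors, act on B, swap back.\<close>

lemma psd_lo_apply:
  assumes A: "channel dA qA PhiA" and B: "channel dB qB PhiB" and rho: "psd (dA * dB) rho"
    and pos: "1 \<le> dB" "1 \<le> qA"
  shows "psd (qA * qB) (lo_apply dA dB qB PhiA PhiB rho)"
proof -
  define s1 where "s1 = ampl dB PhiA rho"
  define s2 where "s2 = (\<lambda>u w. s1 ((u mod qA) * dB + u div qA) ((w mod qA) * dB + w div qA))"
  define s3 where "s3 = ampl qA PhiB s2"
  define s4 where "s4 = (\<lambda>u w. s3 ((u mod qB) * qA + u div qB) ((w mod qB) * qA + w div qB))"
  have "psd (qA * dB) s1" unfolding s1_def by (rule channelD(4)[OF A pos(1) rho])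
  then have "psd (dB * qA) s2" unfolding s2_def by (rule psd_swap)
  then have "psd (qB * qA) s3" unfolding s3_def by (rule channelD(4)[OF B pos(2)])
  then have 4: "psd (qA * qB) s4" unfolding s4_def by (rule psd_swap)
  have "s4 u w = lo_apply dA dB qB PhiA PhiB rho u w" if "u < qA * qB" "w < qA * qB" for u w
  proof -
    define r s r' s' where "r = u div qB" and "s = u mod qB" and "r' = w div qB" and "s' = w mod qB"
    have u: "u = r * qB + s" "w = r' * qB + s'" by (simp_all add: r_def s_def r'_def s'_def)
    have "0 < qB" using that by (auto intro: gr0I)
    then have rs: "r < qA" "r' < qA" "s < qB" "s' < qB"
      using that by (auto simp: r_def s_def r'_def s'_def less_mult_imp_div_less)
    have "s4 u w = PhiB (\<lambda>b b'. s2 (b * qA + r) (b' * qA + r')) s s'"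
      using rs by (simp add: s4_def s3_def ampl_def u)
    also have "\<dots> = PhiB (\<lambda>b b'. PhiA (\<lambda>a a'. rho (a * dB + b) (a' * dB + b')) r r') s s'"
    proof (rule channelD(1)[OF B _ rs(3,4)])
      fix b b' assume "b < dB" "b' < dB"
      then show "s2 (b * qA + r) (b' * qA + r') = PhiA (\<lambda>a a'. rho (a * dB + b) (a' * dB + b')) r r'"
        using rs by (simp add: s2_def s1_def ampl_def)
    qed
    also have "\<dots> = lo_apply dA dB qB PhiA PhiB rho u w"
      unfolding u using lo_apply_tensor[OF A B rs] by simp
    finally show ?thesis .
  qed
  then show ?thesis using 4 psd_cong by blast
qed

lemma mtrace_lo_apply:
  assumes A: "channel dA qA PhiA" and B: "channel dB qB PhiB"
  shows "mtrace (qA * qB) (lo_apply dA dB qB PhiA PhiB rho) = mtrace (dA * dB) rho"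
proof -
  let ?L = "lo_apply dA dB qB PhiA PhiB rho"
  have "mtrace (qA * qB) ?L = (\<Sum>r<qA. mtrace qB (PhiB (\<lambda>b b'. PhiA (\<lambda>a a'. rho (a * dB + b) (a' * dB + b')) r r)))"
    unfolding mtrace_def sum_divmod by (intro sum.cong refl lo_apply_tensor[OF A B]) auto
  also have "\<dots> = (\<Sum>r<qA. \<Sum>b<dB. PhiA (\<lambda>a a'. rho (a * dB + b) (a' * dB + b)) r r)"
    unfolding channelD(3)[OF B] by (simp add: mtrace_def)
  also have "\<dots> = (\<Sum>b<dB. mtrace qA (PhiA (\<lambda>a a'. rho (a * dB + b) (a' * dB + b))))"
    unfolding mtrace_def by (rule sum.swap)
  also have "\<dots> = (\<Sum>b<dB. \<Sum>a<dA. rho (a * dB + b) (a * dB + b))"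
    unfolding channelD(3)[OF A] by (simp add: mtrace_def)
  also have "\<dots> = mtrace (dA * dB) rho" unfolding mtrace_def sum_divmod by (rule sum.swap)
  finally show ?thesis .
qed

text \<open>Only the compression \<open>Y\<close> of \<open>X\<close> to the vectors
  \<open>|r>|r>\<close> matters: the overlap is the sum of all entries of \<open>Y\<close> divided
  by \<open>M\<close>, at most the trace of \<open>Y\<close>, which is part of the trace of
  \<open>X\<close>.\<close>

lemma epr_overlap_bounds:
  assumes X: "psd (2^m * 2^m) X"
  shows "Im (epr_overlap m X) = 0" "0 \<le> Re (epr_overlap m X)"
    "Re (epr_overlap m X) \<le> Re (mtrace (2^m * 2^m) X)"
proof -
  define M :: nat where "M = 2 ^ m"
  have M: "0 < M" by (simp add: M_def)
  define Y where "Y = (\<lambda>r r'. X (r * M + r) (r' * M + r'))"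
  have X': "psd (M * M) X" using X by (simp add: M_def)
  have Y: "psd M Y" unfolding Y_def by (rule psd_reindex[OF X']) (rule less_mult_divmod)
  have ov: "epr_overlap m X = (\<Sum>r<M. \<Sum>r'<M. Y r r') / of_nat M"
    by (simp add: epr_overlap_def Y_def M_def)
  have qf: "(\<Sum>r<M. \<Sum>r'<M. Y r r') = qform M Y (\<lambda>_. 1)" by (simp add: qform_def)
  have re: "Re (z / of_nat M) = Re z / M" "Im (z / of_nat M) = Im z / M" for z
    by (metis Re_divide_of_nat Im_divide_of_nat)+
  show "Im (epr_overlap m X) = 0" "0 \<le> Re (epr_overlap m X)"
    unfolding ov re qf using psd_qformD[OF Y, of "\<lambda>_. 1"] by auto
  have "Re (epr_overlap m X) \<le> Re (mtrace M Y)"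
    unfolding ov re using psd_sum_le_trace[OF Y] M by (simp add: divide_le_eq mult.commute)
  also have "\<dots> = (\<Sum>r<M. Re (X (r * M + r) (r * M + r)))" by (simp add: mtrace_def Y_def)
  also have "\<dots> \<le> (\<Sum>r<M. \<Sum>s<M. Re (X (r * M + s) (r * M + s)))"
    using psd_diag(2)[OF X'] less_mult_divmod[of _ M _ M]
    by (intro sum_mono member_le_sum) auto
  also have "\<dots> = Re (mtrace (M * M) X)" by (simp add: mtrace_def sum_divmod)
  finally show "Re (epr_overlap m X) \<le> Re (mtrace (2^m * 2^m) X)" by (simp add: M_def)
qed

text \<open>Entries of the Choi matrix: its diagonal is at most 1 by trace preservation, the rest
  follows by Cauchy-Schwarz. Choi coefficients thus lie in the closed unit polydisc, as needed for
  compactness and for membership in \<open>body\<close>.\<close>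

lemma channel_entry_le:
  assumes ch: "channel p q Phi" and "a < p" "a' < p" "r < q" "r' < q"
  shows "cmod (Phi (unitm a a') r r') \<le> 1"
proof -
  \<comment> \<open>The unnormalised projector onto the maximally entangled vector; amplifying the
    channel on it yields the Choi matrix.\<close>
  define X where "X = (\<lambda>u w::nat. if u div p = u mod p \<and> w div p = w mod p then 1 else 0 :: complex)"
  have "psd (p * p) X"
  proof -
    have "qform (p * p) X v = of_real ((cmod (\<Sum>u<p * p. if u div p = u mod p then v u else 0))\<^sup>2)" for v
    proof -
      define g where "g = (\<lambda>u. if u div p = u mod p then v u else 0)"
      have "qform (p * p) X v = (\<Sum>u<p * p. \<Sum>w<p * p. g w * cnj (g u))"
        unfolding qform_def X_def g_def by (intro sum.cong) auto
      also have "\<dots> = (\<Sum>w<p * p. \<Sum>u<p * p. g w * cnj (g u))" by (rule sum.swap)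
      also have "\<dots> = (\<Sum>w<p * p. g w) * cnj (\<Sum>u<p * p. g u)" by (simp only: cnj_sum sum_product)
      also have "\<dots> = of_real ((cmod (\<Sum>u<p * p. g u))\<^sup>2)" by (rule complex_norm_square[symmetric])
      finally show ?thesis by (simp add: g_def)
    qed
    then show ?thesis by (simp add: psd_qform)
  qed
  then have Y: "psd (q * p) (ampl p Phi X)" using assms by (intro channelD(4)[OF ch]) auto
  have ent: "ampl p Phi X (r * p + a) (r' * p + a') = Phi (unitm a a') r r'"
    if "a < p" "a' < p" for a a' r r'
  proof -
    have "(\<lambda>x y. X (x * p + a) (y * p + a')) = unitm a a'"
      using that by (auto simp: X_def unitm_def fun_eq_iff)
    then show ?thesis using that by (simp add: ampl_def)
  qed
  have diag: "Re (Phi (unitm a a) r r) \<le> 1" if "a < p" "r < q" for a r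
  proof -
    have ge: "0 \<le> Re (Phi (unitm a a) s s)" if "s < q" for s
      using psd_diag(2)[OF Y less_mult_divmod[OF that \<open>a < p\<close>]] ent[OF \<open>a < p\<close> \<open>a < p\<close>] by simp
    have "Re (Phi (unitm a a) r r) \<le> (\<Sum>s<q. Re (Phi (unitm a a) s s))"
      using that ge by (intro member_le_sum) auto
    also have "\<dots> = Re (mtrace q (Phi (unitm a a)))" by (simp add: mtrace_def)
    also have "\<dots> = 1" using that by (simp add: channelD(3)[OF ch] mtrace_unitm)
    finally show ?thesis .
  qed
  have l: "r * p + a < q * p" "r' * p + a' < q * p" using assms by (auto intro: less_mult_divmod)
  have "(cmod (Phi (unitm a a') r r'))\<^sup>2 \<le> Re (Phi (unitm a a) r r) * Re (Phi (unitm a' a') r' r')"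
    using psd_cauchy_schwarz[OF Y l] ent assms by simp
  also have "\<dots> \<le> 1 * 1"
    using diag assms psd_diag(2)[OF Y l(2)] ent by (intro mult_mono) auto
  finally show ?thesis by (simp add: abs_square_le_1)
qed

text \<open>The sum over \<open>a\<close> is the image of the identity matrix, written in Choi
  coefficients.\<close>

lemma channel_id:
  assumes ch: "channel p q Phi"
  shows "psd q (\<lambda>r r'. \<Sum>a<p. Phi (unitm a a) r r')"
    "Re (mtrace q (\<lambda>r r'. \<Sum>a<p. Phi (unitm a a) r r')) = p"
proof -
  have u: "psd p (unitm a a)" for a
  proof -
    have "qform p (unitm a a) v = (\<Sum>i<p. if i = a then of_real ((cmod (v i))\<^sup>2) else 0)" for v
    proof -
      have "qform p (unitm a a) v = (\<Sum>i<p. \<Sum>j<p. if j = i then (if i = a then cnj (v i) * v i else 0) else 0)"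
        unfolding qform_def unitm_def by (intro sum.cong) auto
      also have "\<dots> = (\<Sum>i<p. if i = a then of_real ((cmod (v i))\<^sup>2) else 0)"
        by (intro sum.cong) (auto simp: complex_norm_square mult.commute simp del: of_real_power)
      finally show ?thesis .
    qed
    then show ?thesis unfolding psd_qform by simp
  qed
  then show "psd q (\<lambda>r r'. \<Sum>a<p. Phi (unitm a a) r r')"
    by (intro psd_sum channel_psd[OF ch])
  have "mtrace q (\<lambda>r r'. \<Sum>a<p. Phi (unitm a a) r r') = (\<Sum>a<p. mtrace q (Phi (unitm a a)))"
    unfolding mtrace_def by (rule sum.swap)
  also have "\<dots> = of_nat p" by (simp add: channelD(3)[OF ch] mtrace_unitm)
  finally show "Re (mtrace q (\<lambda>r r'. \<Sum>a<p. Phi (unitm a a) r r')) = p" by simp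
qed

section \<open>Discarding EPR pairs and monotonicity in the number of pairs\<close>

definition ptr_out :: "nat \<Rightarrow> (cmat \<Rightarrow> cmat) \<Rightarrow> cmat \<Rightarrow> cmat" where
  "ptr_out E Phi X = (\<lambda>i j. \<Sum>e<E. Phi X (i * E + e) (j * E + e))"

lemma channel_ptr_out:
  assumes ch: "channel p (q * E) Phi"
  shows "channel p q (ptr_out E Phi)"
  unfolding channel_def
proof (intro conjI allI impI)
  fix X Y :: cmat and i j assume "\<forall>i<p. \<forall>j<p. X i j = Y i j" and ij: "i < q" "j < q"
  then have "Phi X (i * E + e) (j * E + e) = Phi Y (i * E + e) (j * E + e)" if "e < E" for e
    using less_mult_divmod[OF ij(1) that] less_mult_divmod[OF ij(2) that] by (intro channelD(1)[OF ch]) auto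
  then show "ptr_out E Phi X i j = ptr_out E Phi Y i j" by (simp add: ptr_out_def)
next
  fix a :: complex and X Y :: cmat and i j assume ij: "i < q" "j < q"
  have "Phi (\<lambda>r s. a * X r s + Y r s) (i * E + e) (j * E + e)
      = a * Phi X (i * E + e) (j * E + e) + Phi Y (i * E + e) (j * E + e)" if "e < E" for e
    using less_mult_divmod[OF ij(1) that] less_mult_divmod[OF ij(2) that] by (intro channelD(2)[OF ch])
  then show "ptr_out E Phi (\<lambda>r s. a * X r s + Y r s) i j = a * ptr_out E Phi X i j + ptr_out E Phi Y i j"
    by (simp add: ptr_out_def sum.distrib sum_distrib_left)
next
  fix X
  have "mtrace q (ptr_out E Phi X) = mtrace (q * E) (Phi X)"
    by (simp add: mtrace_def ptr_out_def sum_divmod)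
  then show "mtrace q (ptr_out E Phi X) = mtrace p X" by (simp add: channelD(3)[OF ch])
next
  fix k :: nat and X assume k: "1 \<le> k" and "psd (p * k) X"
  then have Y: "psd (q * E * k) (ampl k Phi X)" by (intro channelD(4)[OF ch])
  \<comment> \<open>Output and ancilla indices with the discarded index \<open>e\<close> reinserted
    between them; the amplified partial trace becomes a sum of compressions.\<close>
  define f where "f = (\<lambda>e u. ((u div k) * E + e) * k + u mod k)"
  have "psd (q * k) (\<lambda>u w. \<Sum>e<E. ampl k Phi X (f e u) (f e w))"
  proof (rule psd_sum, rule psd_reindex[OF Y])
    fix e u assume "e \<in> {..<E}" "u < q * k"
    then show "f e u < q * E * k"
      unfolding f_def using k by (intro less_mult_divmod) (auto simp: less_mult_imp_div_less)
  qed
  moreover have "(\<lambda>u w. \<Sum>e<E. ampl k Phi X (f e u) (f e w)) = ampl k (ptr_out E Phi) X"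
    using k by (auto simp: ampl_def ptr_out_def f_def fun_eq_iff)
  ultimately show "psd (q * k) (ampl k (ptr_out E Phi) X)" by simp
qed

lemma Re_divide_nat: "Re (z / of_nat n) = Re z / n"
  by (metis Re_divide_of_nat)

text \<open>The reduced overlap collects the vectors \<open>|e f>\<close> of the discarded systems; the diagonal
  \<open>e = f\<close> alone dominates the original overlap, by convexity.\<close>

lemma epr_overlap_ptr_out:
  assumes A: "channel dA (2 ^ (m + l)) PhiA" and B: "channel dB (2 ^ (m + l)) PhiB"
    and rho: "psd (dA * dB) rho" and pos: "1 \<le> dB"
  shows "Re (epr_overlap (m + l) (lo_apply dA dB (2 ^ (m + l)) PhiA PhiB rho))
    \<le> Re (epr_overlap m (lo_apply dA dB (2 ^ m) (ptr_out (2 ^ l) PhiA) (ptr_out (2 ^ l) PhiB) rho))"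
proof -
  define M :: nat where "M = 2 ^ m"
  define E :: nat where "E = 2 ^ l"
  have ME: "0 < M" "0 < E" by (auto simp: M_def E_def)
  have pw: "(2::nat) ^ (m + l) = M * E" by (simp add: M_def E_def power_add)
  define L where "L = lo_apply dA dB (M * E) PhiA PhiB rho"
  define L' where "L' = lo_apply dA dB M (ptr_out E PhiA) (ptr_out E PhiB) rho"
  have L: "psd ((M * E) * (M * E)) L"
    unfolding L_def using A B rho pos ME by (intro psd_lo_apply) (auto simp: pw)
  \<comment> \<open>The index of the product basis vector \<open>|r e>\<close> on the first side
    times \<open>|r f>\<close> on the second; the kept register is the more significant
    part.\<close>
  define Z where "Z = (\<lambda>e f r. (r * E + e) * (M * E) + (r * E + f))"
  have Zlt: "Z e f r < (M * E) * (M * E)" if "e < E" "f < E" "r < M" for e f r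
    unfolding Z_def using that by (intro less_mult_divmod)
  have ptr: "L' (r * M + r) (r' * M + r') = (\<Sum>e<E. \<Sum>f<E. L (Z e f r) (Z e f r'))" if "r < M" "r' < M" for r r'
  proof -
    have prod: "c * (\<Sum>e<E. F e) * (\<Sum>f<E. H f) = (\<Sum>e<E. \<Sum>f<E. c * F e * H f)" for c :: complex and F H
    proof -
      have "c * (\<Sum>e<E. F e) * (\<Sum>f<E. H f) = c * (\<Sum>e<E. \<Sum>f<E. F e * H f)"
        by (simp only: mult.assoc sum_product)
      then show ?thesis by (simp add: sum_distrib_left mult.assoc)
    qed
    have "L' (r * M + r) (r' * M + r') = (\<Sum>a<dA. \<Sum>a'<dA. \<Sum>b<dB. \<Sum>b'<dB. \<Sum>e<E. \<Sum>f<E.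
        rho (a * dB + b) (a' * dB + b') * PhiA (unitm a a') (r * E + e) (r' * E + e) * PhiB (unitm b b') (r * E + f) (r' * E + f))"
      using that by (simp add: L'_def lo_apply_def ptr_out_def prod)
    also have "\<dots> = (\<Sum>a<dA. \<Sum>a'<dA. \<Sum>e<E. \<Sum>f<E. \<Sum>b<dB. \<Sum>b'<dB.
        rho (a * dB + b) (a' * dB + b') * PhiA (unitm a a') (r * E + e) (r' * E + e) * PhiB (unitm b b') (r * E + f) (r' * E + f))"
      by (rule sum.cong[OF refl], rule sum.cong[OF refl], rule sum_swap_pairs)
    also have "\<dots> = (\<Sum>e<E. \<Sum>f<E. \<Sum>a<dA. \<Sum>a'<dA. \<Sum>b<dB. \<Sum>b'<dB.
        rho (a * dB + b) (a' * dB + b') * PhiA (unitm a a') (r * E + e) (r' * E + e) * PhiB (unitm b b') (r * E + f) (r' * E + f))"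
      by (rule sum_swap_pairs)
    also have "\<dots> = (\<Sum>e<E. \<Sum>f<E. L (Z e f r) (Z e f r'))"
    proof (intro sum.cong refl)
      fix e f assume "e \<in> {..<E}" "f \<in> {..<E}"
      then have lt: "r * E + f < M * E" "r' * E + f < M * E" using that less_mult_divmod by auto
      have dm: "(x * k + y) div k = x" "(x * k + y) mod k = y" if "y < k" for x y k :: nat
        using that by auto
      show "(\<Sum>a<dA. \<Sum>a'<dA. \<Sum>b<dB. \<Sum>b'<dB.
        rho (a * dB + b) (a' * dB + b') * PhiA (unitm a a') (r * E + e) (r' * E + e) * PhiB (unitm b b') (r * E + f) (r' * E + f))
        = L (Z e f r) (Z e f r')"
        unfolding L_def lo_apply_def Z_def dm[OF lt(1)] dm[OF lt(2)] ..
    qed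
    finally show ?thesis .
  qed
  define G where "G = (\<lambda>e f e' f'. \<Sum>r<M. \<Sum>r'<M. L (Z e f r) (Z e' f' r'))"
  have G_nonneg: "0 \<le> Re (G e f e f)" if "e < E" "f < E" for e f
  proof -
    have "psd M (\<lambda>r r'. L (Z e f r) (Z e f r'))"
      by (rule psd_reindex[OF L]) (rule Zlt[OF that])
    from psd_qformD(2)[OF this, of "\<lambda>_. 1"] show ?thesis by (simp add: G_def qform_def)
  qed
  \<comment> \<open>Summing all entries over pairs (e, e') costs at most a factor \<open>E\<close>
    over the diagonal, and this factor cancels against the normalisation \<open>M * E\<close> of the
    larger overlap.\<close>
  have Y: "psd E (\<lambda>e e'. G e e e' e')"
  proof -
    have "psd (E * M) (\<lambda>u w. L (Z (u div M) (u div M) (u mod M)) (Z (w div M) (w div M) (w mod M)))"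
      using ME by (intro psd_reindex[OF L] Zlt) (auto simp: less_mult_imp_div_less)
    from psd_block_sum[OF this] show ?thesis by (simp add: G_def)
  qed
  have "(\<Sum>s<M * E. \<Sum>s'<M * E. L (s * (M * E) + s) (s' * (M * E) + s'))
      = (\<Sum>r<M. \<Sum>e<E. \<Sum>r'<M. \<Sum>e'<E. L (Z e e r) (Z e' e' r'))"
    unfolding sum_divmod Z_def ..
  also have "\<dots> = (\<Sum>e<E. \<Sum>r<M. \<Sum>r'<M. \<Sum>e'<E. L (Z e e r) (Z e' e' r'))" by (rule sum.swap)
  also have "\<dots> = (\<Sum>e<E. \<Sum>r<M. \<Sum>e'<E. \<Sum>r'<M. L (Z e e r) (Z e' e' r'))"
    by (intro sum.cong[OF refl], rule sum.swap)
  also have "\<dots> = (\<Sum>e<E. \<Sum>e'<E. G e e e' e')"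
    unfolding G_def by (intro sum.cong[OF refl], rule sum.swap)
  finally have "Re (epr_overlap (m + l) L) = Re (\<Sum>e<E. \<Sum>e'<E. G e e e' e') / (M * E)"
    unfolding epr_overlap_def pw Re_divide_nat by simp
  also have "\<dots> \<le> (E * Re (mtrace E (\<lambda>e e'. G e e e' e'))) / (M * E)"
    using psd_sum_le_trace[OF Y] by (intro divide_right_mono) auto
  also have "\<dots> = (\<Sum>e<E. Re (G e e e e)) / M" using ME by (simp add: mtrace_def)
  also have "\<dots> \<le> (\<Sum>e<E. \<Sum>f<E. Re (G e f e f)) / M"
    using G_nonneg by (intro divide_right_mono sum_mono member_le_sum) auto
  also have "\<dots> = Re (epr_overlap m L')"
  proof -
    have "(\<Sum>r<M. \<Sum>r'<M. L' (r * M + r) (r' * M + r')) = (\<Sum>r<M. \<Sum>r'<M. \<Sum>e<E. \<Sum>f<E. L (Z e f r) (Z e f r'))"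
      using ptr by simp
    also have "\<dots> = (\<Sum>e<E. \<Sum>f<E. G e f e f)" unfolding G_def by (rule sum_swap_pairs)
    finally show ?thesis unfolding epr_overlap_def M_def[symmetric] Re_divide_nat by simp
  qed
  finally show ?thesis by (simp add: L_def L'_def pw M_def E_def)
qed

lemma lo_achievable_mono:
  assumes "lo_achievable dA dB rho h m'" "m \<le> m'" "psd (dA * dB) rho" "1 \<le> dB"
  shows "lo_achievable dA dB rho h m"
proof -
  obtain l where l: "m' = m + l" using assms(2) le_Suc_ex by blast
  from assms(1) obtain PhiA PhiB where P: "channel dA (2 ^ (m + l)) PhiA" "channel dB (2 ^ (m + l)) PhiB"
    "h\<^sup>2 \<le> Re (epr_overlap (m + l) (lo_apply dA dB (2 ^ (m + l)) PhiA PhiB rho))"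
    unfolding lo_achievable_def l by blast
  have "h\<^sup>2 \<le> Re (epr_overlap m (lo_apply dA dB (2 ^ m) (ptr_out (2 ^ l) PhiA) (ptr_out (2 ^ l) PhiB) rho))"
    using P(3) epr_overlap_ptr_out[OF P(1,2) assms(3,4)] by simp
  moreover have "channel dA (2 ^ m) (ptr_out (2 ^ l) PhiA)" "channel dB (2 ^ m) (ptr_out (2 ^ l) PhiB)"
    using P(1,2) by (auto intro!: channel_ptr_out simp: power_add)
  ultimately show ?thesis unfolding lo_achievable_def by blast
qed

text \<open>The supremum may be infinite or attained beyond \<open>m\<close>. If no
  \<open>m' \<ge> m\<close> were achievable, the supremum would be at most \<open>m - 1\<close>,
  which is below \<open>m\<close> as \<open>0 < m\<close>; monotonicity then descends from
  \<open>m'\<close> to \<open>m\<close>.\<close>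

lemma le_ED_LO_iff:
  assumes "psd (dA * dB) rho" "1 \<le> dB" "0 < m"
  shows "enat m \<le> ED_LO dA dB rho h \<longleftrightarrow> lo_achievable dA dB rho h m"
proof
  assume "lo_achievable dA dB rho h m"
  then show "enat m \<le> ED_LO dA dB rho h" unfolding ED_LO_def by (intro Sup_upper) auto
next
  assume *: "enat m \<le> ED_LO dA dB rho h"
  have "\<exists>m'\<ge>m. lo_achievable dA dB rho h m'"
  proof (rule ccontr)
    assume "\<not> ?thesis"
    then have "m' \<le> m - 1" if "lo_achievable dA dB rho h m'" for m'
      using that by (metis One_nat_def Suc_pred assms(3) less_Suc_eq_le not_le)
    then have "ED_LO dA dB rho h \<le> enat (m - 1)"
      unfolding ED_LO_def by (intro Sup_least) auto
    with * have "enat m \<le> enat (m - 1)" by (rule order_trans)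
    then show False using assms(3) by simp
  qed
  then show "lo_achievable dA dB rho h m" using lo_achievable_mono assms(1,2) by blast
qed

lemma psd_rhoAB: "psd n (rhoAB dC psi)"
proof -
  have "qform n (\<lambda>i j. psi (i * dC + c) * cnj (psi (j * dC + c))) v
      = of_real ((cmod (\<Sum>i<n. cnj (v i) * psi (i * dC + c)))\<^sup>2)" for v c
  proof -
    have "qform n (\<lambda>i j. psi (i * dC + c) * cnj (psi (j * dC + c))) v
      = (\<Sum>i<n. cnj (v i) * psi (i * dC + c)) * cnj (\<Sum>i<n. cnj (v i) * psi (i * dC + c))"
      unfolding cnj_sum sum_product qform_def by (intro sum.cong) (auto simp: mult_ac)
    then show ?thesis by (simp only: complex_norm_square)
  qed
  then have "psd n (\<lambda>i j. psi (i * dC + c) * cnj (psi (j * dC + c)))" for c by (simp add: psd_qform)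
  then show ?thesis unfolding rhoAB_def by (intro psd_sum)
qed

lemma mtrace_rhoAB: "mtrace n (rhoAB dC psi) = of_real (sqnorm {..<n * dC} psi)"
proof -
  have "mtrace n (rhoAB dC psi) = (\<Sum>i<n. \<Sum>c<dC. of_real ((cmod (psi (i * dC + c)))\<^sup>2))"
    unfolding mtrace_def rhoAB_def by (intro sum.cong) (auto simp: complex_norm_square simp del: of_real_power)
  also have "\<dots> = of_real (sqnorm {..<n * dC} psi)" by (simp add: sqnorm_def sum_divmod)
  finally show ?thesis .
qed

section \<open>The compact set of Choi matrices\<close>

type_synonym choi = "nat \<times> nat \<times> nat \<times> nat \<Rightarrow> complex"

definition cidx :: "nat \<Rightarrow> nat \<Rightarrow> (nat \<times> nat \<times> nat \<times> nat) set" where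
  "cidx p q = {..<p} \<times> {..<p} \<times> {..<q} \<times> {..<q}"

definition chan_of :: "nat \<Rightarrow> choi \<Rightarrow> cmat \<Rightarrow> cmat" where
  "chan_of p J X = (\<lambda>r r'. \<Sum>a<p. \<Sum>a'<p. X a a' * J (a, a', r, r'))"

text \<open>Membership in the space fixes all coordinates off the index set to
  \<open>undefined\<close>; without this the set could not be compact in the full function
  space.\<close>

definition chans :: "nat \<Rightarrow> nat \<Rightarrow> choi set" where
  "chans p q = {J \<in> space (cprod (cidx p q)). channel p q (chan_of p J)}"

text \<open>Linear in each of the two Choi families and in the state. Both families carry the same
  \<open>r, r'\<close> because the EPR projector reads only entries at equal registers.\<close>

definition ovl :: "nat \<Rightarrow> nat \<Rightarrow> nat \<Rightarrow> choi \<Rightarrow> choi \<Rightarrow> cmat \<Rightarrow> complex" where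
  "ovl dA dB M JA JB rho = (\<Sum>a<dA. \<Sum>a'<dA. \<Sum>b<dB. \<Sum>b'<dB. \<Sum>r<M. \<Sum>r'<M.
     rho (a * dB + b) (a' * dB + b') * JA (a, a', r, r') * JB (b, b', r, r')) / of_nat M"

lemma finite_cidx: "finite (cidx p q)" and card_cidx: "card (cidx p q) = p\<^sup>2 * q\<^sup>2"
  by (simp_all add: cidx_def card_cartesian_product power2_eq_square)

lemma chan_of_unitm:
  assumes "a < p" "a' < p"
  shows "chan_of p J (unitm a a') r r' = J (a, a', r, r')"
proof -
  have "chan_of p J (unitm a a') r r' = (\<Sum>x<p. \<Sum>y<p. if y = a' then (if x = a then J (a, a', r, r') else 0) else 0)"
    unfolding chan_of_def unitm_def by (intro sum.cong) auto
  then show ?thesis using assms by simp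
qed

lemma channel_cong:
  assumes ch: "channel p q Phi" and eq: "\<And>X r s. r < q \<Longrightarrow> s < q \<Longrightarrow> Phi' X r s = Phi X r s"
  shows "channel p q Phi'"
  unfolding channel_def
proof (intro conjI allI impI)
  fix X Y :: cmat and i j assume "\<forall>i<p. \<forall>j<p. X i j = Y i j" "i < q" "j < q"
  then show "Phi' X i j = Phi' Y i j" using channelD(1)[OF ch, of X Y i j] by (simp add: eq)
next
  fix a X Y i j assume "i < q" "j < q"
  then show "Phi' (\<lambda>r s. a * X r s + Y r s) i j = a * Phi' X i j + Phi' Y i j"
    by (simp add: eq channelD(2)[OF ch])
next
  fix X
  show "mtrace q (Phi' X) = mtrace p X" using channelD(3)[OF ch, of X] by (simp add: mtrace_def eq)
next
  fix k :: nat and X assume "1 \<le> k" "psd (p * k) X"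
  then have "psd (q * k) (ampl k Phi X)" by (rule channelD(4)[OF ch])
  moreover have "ampl k Phi X u w = ampl k Phi' X u w" if "u < q * k" "w < q * k" for u w
    using that by (simp add: ampl_def eq less_mult_imp_div_less)
  ultimately show "psd (q * k) (ampl k Phi' X)" using psd_cong by blast
qed

lemma choi_in_chans:
  assumes ch: "channel p q Phi"
  defines "J \<equiv> restrict (\<lambda>(a, a', r, r'). Phi (unitm a a') r r') (cidx p q)"
  shows "J \<in> chans p q"
proof -
  have "chan_of p J X r s = Phi X r s" if "r < q" "s < q" for X r s
    unfolding channel_expand[OF ch that, of X] chan_of_def
    using that by (intro sum.cong) (auto simp: J_def cidx_def)
  then have "channel p q (chan_of p J)" by (rule channel_cong[OF ch])
  then show ?thesis by (simp add: chans_def J_def space_PiM)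
qed

lemma chans_entry_le:
  assumes "J \<in> chans p q" "i \<in> cidx p q"
  shows "cmod (J i) \<le> 1"
proof -
  obtain a a' r r' where i: "i = (a, a', r, r')" "a < p" "a' < p" "r < q" "r' < q"
    using assms(2) by (auto simp: cidx_def)
  have "channel p q (chan_of p J)" using assms(1) by (simp add: chans_def)
  from channel_entry_le[OF this i(2-5)] show ?thesis by (simp add: i(1) chan_of_unitm[OF i(2,3)])
qed

lemma epr_overlap_ovl:
  assumes "\<And>a a' r r'. a < dA \<Longrightarrow> a' < dA \<Longrightarrow> r < 2^m \<Longrightarrow> r' < 2^m \<Longrightarrow> JA (a, a', r, r') = PhiA (unitm a a') r r'"
    and "\<And>b b' r r'. b < dB \<Longrightarrow> b' < dB \<Longrightarrow> r < 2^m \<Longrightarrow> r' < 2^m \<Longrightarrow> JB (b, b', r, r') = PhiB (unitm b b') r r'"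
  shows "epr_overlap m (lo_apply dA dB (2^m) PhiA PhiB rho) = ovl dA dB (2^m) JA JB rho"
proof -
  define M :: nat where "M = 2 ^ m"
  let ?t = "\<lambda>a a' b b' r r'. rho (a * dB + b) (a' * dB + b') * JA (a, a', r, r') * JB (b, b', r, r')"
  have "(\<Sum>r<M. \<Sum>r'<M. lo_apply dA dB M PhiA PhiB rho (r * M + r) (r' * M + r'))
      = (\<Sum>r<M. \<Sum>r'<M. \<Sum>a<dA. \<Sum>a'<dA. \<Sum>b<dB. \<Sum>b'<dB. ?t a a' b b' r r')"
    unfolding lo_apply_def using assms by (intro sum.cong refl) (simp add: M_def)
  also have "\<dots> = (\<Sum>a<dA. \<Sum>a'<dA. \<Sum>r<M. \<Sum>r'<M. \<Sum>b<dB. \<Sum>b'<dB. ?t a a' b b' r r')"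
    by (rule sum_swap_pairs)
  also have "\<dots> = (\<Sum>a<dA. \<Sum>a'<dA. \<Sum>b<dB. \<Sum>b'<dB. \<Sum>r<M. \<Sum>r'<M. ?t a a' b b' r r')"
    by (rule sum.cong[OF refl], rule sum.cong[OF refl], rule sum_swap_pairs)
  finally show ?thesis by (simp add: epr_overlap_def ovl_def M_def)
qed

lemma ovl_chans:
  assumes "JA \<in> chans dA (2^m)" "JB \<in> chans dB (2^m)"
  shows "ovl dA dB (2^m) JA JB rho = epr_overlap m (lo_apply dA dB (2^m) (chan_of dA JA) (chan_of dB JB) rho)"
  by (rule epr_overlap_ovl[symmetric]) (simp_all add: chan_of_unitm)

lemma lo_achievable_iff:
  "lo_achievable dA dB rho h m \<longleftrightarrow>
    (\<exists>JA\<in>chans dA (2^m). \<exists>JB\<in>chans dB (2^m). h\<^sup>2 \<le> Re (ovl dA dB (2^m) JA JB rho))"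
proof
  assume "lo_achievable dA dB rho h m"
  then obtain PhiA PhiB where P: "channel dA (2^m) PhiA" "channel dB (2^m) PhiB"
      "h\<^sup>2 \<le> Re (epr_overlap m (lo_apply dA dB (2^m) PhiA PhiB rho))"
    unfolding lo_achievable_def by blast
  let ?J = "\<lambda>p Phi. restrict (\<lambda>(a, a', r, r'). Phi (unitm a a') r r') (cidx p (2^m))"
  have "epr_overlap m (lo_apply dA dB (2^m) PhiA PhiB rho) = ovl dA dB (2^m) (?J dA PhiA) (?J dB PhiB) rho"
    by (rule epr_overlap_ovl) (simp_all add: cidx_def)
  then show "\<exists>JA\<in>chans dA (2^m). \<exists>JB\<in>chans dB (2^m). h\<^sup>2 \<le> Re (ovl dA dB (2^m) JA JB rho)"
    using P choi_in_chans[OF P(1)] choi_in_chans[OF P(2)] by auto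
next
  assume "\<exists>JA\<in>chans dA (2^m). \<exists>JB\<in>chans dB (2^m). h\<^sup>2 \<le> Re (ovl dA dB (2^m) JA JB rho)"
  then obtain JA JB where J: "JA \<in> chans dA (2^m)" "JB \<in> chans dB (2^m)" "h\<^sup>2 \<le> Re (ovl dA dB (2^m) JA JB rho)"
    by blast
  then show "lo_achievable dA dB rho h m"
    unfolding lo_achievable_def ovl_chans[OF J(1,2)] chans_def by blast
qed

lemma ovl_bounds:
  assumes J: "JA \<in> chans dA (2^m)" "JB \<in> chans dB (2^m)" and "1 \<le> dB"
  shows "Im (ovl dA dB (2^m) JA JB (rhoAB dC psi)) = 0"
    "0 \<le> Re (ovl dA dB (2^m) JA JB (rhoAB dC psi))"
    "Re (ovl dA dB (2^m) JA JB (rhoAB dC psi)) \<le> sqnorm {..<dA * dB * dC} psi"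
proof -
  have ch: "channel dA (2^m) (chan_of dA JA)" "channel dB (2^m) (chan_of dB JB)"
    using J by (auto simp: chans_def)
  let ?L = "lo_apply dA dB (2^m) (chan_of dA JA) (chan_of dB JB) (rhoAB dC psi)"
  have "psd (2^m * 2^m) ?L" using assms(3) by (intro psd_lo_apply[OF ch] psd_rhoAB) auto
  from epr_overlap_bounds[OF this] mtrace_lo_apply[OF ch, of "rhoAB dC psi"]
  show "Im (ovl dA dB (2^m) JA JB (rhoAB dC psi)) = 0"
    "0 \<le> Re (ovl dA dB (2^m) JA JB (rhoAB dC psi))"
    "Re (ovl dA dB (2^m) JA JB (rhoAB dC psi)) \<le> sqnorm {..<dA * dB * dC} psi"
    by (simp_all add: ovl_chans[OF J] mtrace_rhoAB)
qed

lemma cmod_ovl_le: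
  assumes "JA \<in> chans dA (2^m)" "JB \<in> chans dB (2^m)" "1 \<le> dB"
  shows "cmod (ovl dA dB (2^m) JA JB (rhoAB dC psi)) \<le> sqnorm {..<dA * dB * dC} psi"
  using ovl_bounds[OF assms, of dC psi] by (simp add: cmod_eq_Re)

lemma channel_chan_of_iff:
  "channel p q (chan_of p J) \<longleftrightarrow> (\<forall>X. mtrace q (chan_of p J X) = mtrace p X) \<and>
    (\<forall>k\<ge>1. \<forall>X. psd (p * k) X \<longrightarrow> psd (q * k) (ampl k (chan_of p J) X))"
proof -
  have "chan_of p J X i j = chan_of p J Y i j" if "\<forall>i<p. \<forall>j<p. X i j = Y i j" for X Y i j
    unfolding chan_of_def using that by (intro sum.cong refl) auto
  moreover have "chan_of p J (\<lambda>r s. a * X r s + Y r s) i j = a * chan_of p J X i j + chan_of p J Y i j" for a X Y i j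
    by (simp add: chan_of_def sum.distrib sum_distrib_left algebra_simps)
  ultimately show ?thesis unfolding channel_def by blast
qed

text \<open>For fixed \<open>k\<close> and \<open>X\<close> each condition is a closed one on
  finitely many coordinates of \<open>J\<close>, and the hypothesis that \<open>X\<close> is
  positive does not involve \<open>J\<close>; the set is an intersection of such conditions.\<close>

lemma closed_chans: "closed (chans p q)"
proof -
  have "chans p q = {J. (\<forall>i. i \<notin> cidx p q \<longrightarrow> J i = undefined) \<and>
      (\<forall>X. mtrace q (chan_of p J X) = mtrace p X) \<and>
      (\<forall>k. 1 \<le> k \<longrightarrow> (\<forall>X. psd (p * k) X \<longrightarrow> psd (q * k) (ampl k (chan_of p J) X)))}"
    unfolding chans_def channel_chan_of_iff space_PiM by (auto simp: PiE_iff extensional_def)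
  also have "closed \<dots>"
    unfolding mtrace_def psd_def ampl_def chan_of_def
    by (intro closed_Collect_conj closed_Collect_all closed_Collect_imp open_Collect_const
        closed_Collect_eq closed_Collect_le continuous_intros)
  finally show ?thesis .
qed

text \<open>Tychonoff: a closed subset of a product of discs on the index set and of singletons
  elsewhere.\<close>

lemma compact_chans: "compact (chans p q)"
proof -
  let ?F = "\<lambda>i. if i \<in> cidx p q then cball 0 1 else {undefined :: complex}"
  have "compactin (product_topology (\<lambda>_. euclidean) UNIV) (PiE UNIV ?F)"
    unfolding compactin_PiE by (auto simp: compactin_euclidean_iff)
  then have "compact (PiE UNIV ?F)" by (simp add: euclidean_product_topology compactin_euclidean_iff)
  moreover have "chans p q \<subseteq> PiE UNIV ?F"
  proof
    fix J assume J: "J \<in> chans p q"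
    then have "J i = undefined" if "i \<notin> cidx p q" for i
      using that unfolding chans_def space_PiM by (auto dest: PiE_arb)
    then show "J \<in> PiE UNIV ?F" using chans_entry_le[OF J] by (auto simp: PiE_iff)
  qed
  ultimately show ?thesis using closed_chans[of p q] by (metis compact_Int_closed inf.absorb_iff2)
qed

lemma closed_Ex_compact:
  fixes S :: "'a::topological_space set" and T :: "('a \<times> 'b::topological_space) set"
  assumes "compact S" "closed T"
  shows "closed {y. \<exists>x\<in>S. (x, y) \<in> T}"
proof -
  have "closed_map (prod_topology (top_of_set S) euclidean) (euclidean :: 'b topology) snd"
    using assms(1) by (intro Abstract_Topological_Spaces.closed_map_snd) (simp add: compact_space_subtopology compactin_euclidean_iff)
  moreover have "closedin (prod_topology (top_of_set S) (euclidean :: 'b topology)) ((S \<times> UNIV) \<inter> T)"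
  proof -
    have "prod_topology (top_of_set S) (euclidean :: 'b topology) = top_of_set (S \<times> UNIV)"
      using prod_topology_subtopology_eu[of S "UNIV :: 'b set"] by simp
    then show ?thesis using assms(2) by (simp add: closedin_closed_Int)
  qed
  ultimately have "closedin euclidean (snd ` ((S \<times> UNIV) \<inter> T))" by (simp add: closed_map_def)
  moreover have "snd ` ((S \<times> UNIV) \<inter> T) = {y. \<exists>x\<in>S. (x, y) \<in> T}"
    by (auto simp: image_iff Bex_def)
  ultimately show ?thesis by (metis closed_closedin)
qed

text \<open>The overlap is jointly continuous in both Choi families and the state, and projecting a
  closed set along a compact factor keeps it closed. This is the source of measurability for the
  event.\<close>

lemma closed_achievable: "closed {psi. lo_achievable dA dB (rhoAB dC psi) h m}"
proof -
  let ?T = "{x :: (choi \<times> choi) \<times> (nat \<Rightarrow> complex).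
    h\<^sup>2 \<le> Re (ovl dA dB (2^m) (fst (fst x)) (snd (fst x)) (rhoAB dC (snd x)))}"
  have "closed ?T"
    unfolding ovl_def rhoAB_def by (intro closed_Collect_le continuous_intros) auto
  then have "closed {psi. \<exists>x\<in>chans dA (2^m) \<times> chans dB (2^m). (x, psi) \<in> ?T}"
    by (intro closed_Ex_compact compact_Times compact_chans)
  moreover have "{psi. \<exists>x\<in>chans dA (2^m) \<times> chans dB (2^m). (x, psi) \<in> ?T}
      = {psi. lo_achievable dA dB (rhoAB dC psi) h m}"
    unfolding lo_achievable_iff by auto
  ultimately show ?thesis by simp
qed

section \<open>Nets of channels\<close>

lemma sum_cidx: "(\<Sum>i\<in>cidx p q. f i) = (\<Sum>a<p. \<Sum>a'<p. \<Sum>r<q. \<Sum>r'<q. f (a, a', r, r'))"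
  by (simp add: cidx_def sum.cartesian_product)

text \<open>The linear functional on the first Choi family obtained by fixing the other channel and
  the state. Such functionals define the norm in which the net is taken.\<close>

definition coefA :: "nat \<Rightarrow> nat \<Rightarrow> choi \<Rightarrow> cmat \<Rightarrow> choi" where
  "coefA dB M JB rho = (\<lambda>(a, a', r, r'). \<Sum>b<dB. \<Sum>b'<dB. rho (a * dB + b) (a' * dB + b') * JB (b, b', r, r') / of_nat M)"

definition coefB :: "nat \<Rightarrow> nat \<Rightarrow> nat \<Rightarrow> choi \<Rightarrow> cmat \<Rightarrow> choi" where
  "coefB dA dB M JA rho = (\<lambda>(b, b', r, r'). \<Sum>a<dA. \<Sum>a'<dA. rho (a * dB + b) (a' * dB + b') * JA (a, a', r, r') / of_nat M)"

lemma ovl_linA: "ovl dA dB M JA JB rho = lin (cidx dA M) (coefA dB M JB rho) JA"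
proof -
  let ?t = "\<lambda>a a' b b' r r'. rho (a * dB + b) (a' * dB + b') * JA (a, a', r, r') * JB (b, b', r, r') / of_nat M"
  have "ovl dA dB M JA JB rho = (\<Sum>a<dA. \<Sum>a'<dA. \<Sum>b<dB. \<Sum>b'<dB. \<Sum>r<M. \<Sum>r'<M. ?t a a' b b' r r')"
    by (simp only: ovl_def sum_divide_distrib)
  also have "\<dots> = (\<Sum>a<dA. \<Sum>a'<dA. \<Sum>r<M. \<Sum>r'<M. \<Sum>b<dB. \<Sum>b'<dB. ?t a a' b b' r r')"
    by (rule sum.cong[OF refl], rule sum.cong[OF refl], rule sum_swap_pairs)
  also have "\<dots> = lin (cidx dA M) (coefA dB M JB rho) JA"
    unfolding lin_def sum_cidx coefA_def prod.case sum_distrib_right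
    by (intro sum.cong refl) simp
  finally show ?thesis .
qed

lemma ovl_linB: "ovl dA dB M JA JB rho = lin (cidx dB M) (coefB dA dB M JA rho) JB"
proof -
  let ?t = "\<lambda>a a' b b' r r'. rho (a * dB + b) (a' * dB + b') * JA (a, a', r, r') * JB (b, b', r, r') / of_nat M"
  have "ovl dA dB M JA JB rho = (\<Sum>a<dA. \<Sum>a'<dA. \<Sum>b<dB. \<Sum>b'<dB. \<Sum>r<M. \<Sum>r'<M. ?t a a' b b' r r')"
    by (simp only: ovl_def sum_divide_distrib)
  also have "\<dots> = (\<Sum>b<dB. \<Sum>b'<dB. \<Sum>a<dA. \<Sum>a'<dA. \<Sum>r<M. \<Sum>r'<M. ?t a a' b b' r r')"
    by (rule sum_swap_pairs)
  also have "\<dots> = (\<Sum>b<dB. \<Sum>b'<dB. \<Sum>r<M. \<Sum>r'<M. \<Sum>a<dA. \<Sum>a'<dA. ?t a a' b b' r r')"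
    by (rule sum.cong[OF refl], rule sum.cong[OF refl], rule sum_swap_pairs)
  also have "\<dots> = lin (cidx dB M) (coefB dA dB M JA rho) JB"
    unfolding lin_def sum_cidx coefB_def prod.case sum_distrib_right
    by (intro sum.cong refl) simp
  finally show ?thesis .
qed

lemma rhoAB_entry_le:
  assumes "sqnorm {..<n * dC} psi \<le> 1" "x < n" "y < n"
  shows "cmod (rhoAB dC psi x y) \<le> 1"
proof -
  note psd = psd_rhoAB[of n dC psi]
  have diag: "Re (rhoAB dC psi x x) \<le> 1" if "x < n" for x
  proof -
    have "Re (rhoAB dC psi x x) \<le> (\<Sum>i<n. Re (rhoAB dC psi i i))"
      using psd_diag(2)[OF psd] that by (intro member_le_sum) auto
    also have "\<dots> = Re (mtrace n (rhoAB dC psi))" by (simp add: mtrace_def)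
    also have "\<dots> \<le> 1" using assms(1) by (simp add: mtrace_rhoAB)
    finally show ?thesis .
  qed
  have "(cmod (rhoAB dC psi x y))\<^sup>2 \<le> Re (rhoAB dC psi x x) * Re (rhoAB dC psi y y)"
    by (rule psd_cauchy_schwarz[OF psd assms(2,3)])
  also have "\<dots> \<le> 1 * 1" using diag assms psd_diag(2)[OF psd] by (intro mult_mono) auto
  finally show ?thesis by (simp add: abs_square_le_1)
qed

lemma cmod_double_sum_le:
  fixes f :: "nat \<Rightarrow> nat \<Rightarrow> complex"
  assumes "\<And>i j. i < n \<Longrightarrow> j < n \<Longrightarrow> cmod (f i j) \<le> 1"
  shows "cmod (\<Sum>i<n. \<Sum>j<n. f i j) \<le> (real n)\<^sup>2"
proof -
  have "cmod (\<Sum>i<n. \<Sum>j<n. f i j) \<le> (\<Sum>i<n. \<Sum>j<n. 1)"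
    by (rule order_trans[OF norm_sum], rule sum_mono, rule order_trans[OF norm_sum], rule sum_mono)
      (auto intro: assms)
  then show ?thesis by (simp add: power2_eq_square)
qed

lemma cmod_coef_term_le:
  assumes "cmod x \<le> 1" "cmod y \<le> 1" "1 \<le> M"
  shows "cmod (x * y / of_nat M) \<le> 1"
proof -
  have "cmod x * cmod y \<le> 1 * 1" using assms by (intro mult_mono) auto
  moreover have "(1::real) \<le> real M" using assms by simp
  ultimately show ?thesis by (simp add: norm_mult norm_divide divide_le_eq)
qed

text \<open>Overlaps with subnormalised states have modulus at most 1, so every channel lies in the
  body of radius 1 for these functionals and the base \<open>1 + 2/e\<close> is free of dimensions.
  The approximation is uniform in the other channel and the state.\<close>

lemma netA:
  assumes e: "0 < e" and "1 \<le> dB"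
  obtains N where "finite N" "N \<subseteq> chans dA (2^m)" "real (card N) \<le> (1 + 2 / e) ^ (2 * (dA\<^sup>2 * (2^m)\<^sup>2))"
    "\<And>JA. JA \<in> chans dA (2^m) \<Longrightarrow> \<exists>J\<in>N. \<forall>JB\<in>chans dB (2^m). \<forall>psi. sqnorm {..<dA * dB * dC} psi \<le> 1 \<longrightarrow>
      cmod (ovl dA dB (2^m) JA JB (rhoAB dC psi) - ovl dA dB (2^m) J JB (rhoAB dC psi)) \<le> e"
proof -
  define A where "A = {coefA dB (2^m) JB (rhoAB dC psi) | JB psi. JB \<in> chans dB (2^m) \<and> sqnorm {..<dA * dB * dC} psi \<le> 1}"
  \<comment> \<open>A crude coordinate bound, needed only to give the body positive volume.\<close>
  have b: "\<forall>a\<in>A. \<forall>i\<in>cidx dA (2^m). cmod (a i) \<le> (real dB)\<^sup>2"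
  proof (intro ballI)
    fix a i assume "a \<in> A" "i \<in> cidx dA (2^m)"
    then obtain JB psi x y r r' where J: "a = coefA dB (2^m) JB (rhoAB dC psi)" "JB \<in> chans dB (2^m)"
        "sqnorm {..<dA * dB * dC} psi \<le> 1"
      and i: "i = (x, y, r, r')" "x < dA" "y < dA" "r < 2^m" "r' < 2^m"
      unfolding A_def cidx_def by blast
    show "cmod (a i) \<le> (real dB)\<^sup>2"
      unfolding J(1) i(1) coefA_def prod.case
    proof (rule cmod_double_sum_le, rule cmod_coef_term_le)
      fix z w assume "z < dB" "w < dB"
      then show "cmod (JB (z, w, r, r')) \<le> 1" using i by (intro chans_entry_le[OF J(2)]) (simp add: cidx_def)
      show "cmod (rhoAB dC psi (x * dB + z) (y * dB + w)) \<le> 1"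
        using i \<open>z < dB\<close> \<open>w < dB\<close> by (intro rhoAB_entry_le[OF J(3)] less_mult_divmod)
    qed simp
  qed
  have K: "chans dA (2^m) \<subseteq> body (cidx dA (2^m)) A 1"
  proof
    fix x assume x: "x \<in> chans dA (2^m)"
    have "cmod (ovl dA dB (2^m) x JB (rhoAB dC psi)) \<le> 1" if J: "JB \<in> chans dB (2^m)" and "sqnorm {..<dA * dB * dC} psi \<le> 1" for JB psi
      using cmod_ovl_le[OF x J assms(2), of dC psi] that(2) by (rule order_trans)
    moreover have "x \<in> space (cprod (cidx dA (2^m)))" using x by (simp add: chans_def)
    ultimately show "x \<in> body (cidx dA (2^m)) A 1"
      using chans_entry_le[OF x] unfolding body_def A_def ovl_linA by blast
  qed
  obtain N where N: "finite N" "N \<subseteq> chans dA (2^m)" "real (card N) \<le> (1 + 2 / e) ^ (2 * card (cidx dA (2^m)))"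
    "\<And>x. x \<in> chans dA (2^m) \<Longrightarrow> \<exists>y\<in>N. \<forall>a\<in>A. cmod (lin (cidx dA (2^m)) a x - lin (cidx dA (2^m)) a y) \<le> e"
    using covering_number[OF finite_cidx b e K] by blast
  show thesis
  proof (rule that[OF N(1,2)])
    show "real (card N) \<le> (1 + 2 / e) ^ (2 * (dA\<^sup>2 * (2^m)\<^sup>2))" using N(3) by (simp add: card_cidx)
    fix JA assume "JA \<in> chans dA (2^m)"
    from N(4)[OF this] obtain J where J: "J \<in> N"
      "\<forall>a\<in>A. cmod (lin (cidx dA (2^m)) a JA - lin (cidx dA (2^m)) a J) \<le> e" by blast
    then show "\<exists>J\<in>N. \<forall>JB\<in>chans dB (2^m). \<forall>psi. sqnorm {..<dA * dB * dC} psi \<le> 1 \<longrightarrow>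
      cmod (ovl dA dB (2^m) JA JB (rhoAB dC psi) - ovl dA dB (2^m) J JB (rhoAB dC psi)) \<le> e"
      unfolding ovl_linA A_def by blast
  qed
qed

text \<open>The mirror image of \<open>netA\<close>. Uniformity in the first channel allows that
  channel to be replaced before the second.\<close>

lemma netB:
  assumes e: "0 < e" and "1 \<le> dB"
  obtains N where "finite N" "N \<subseteq> chans dB (2^m)" "real (card N) \<le> (1 + 2 / e) ^ (2 * (dB\<^sup>2 * (2^m)\<^sup>2))"
    "\<And>JB. JB \<in> chans dB (2^m) \<Longrightarrow> \<exists>J\<in>N. \<forall>JA\<in>chans dA (2^m). \<forall>psi. sqnorm {..<dA * dB * dC} psi \<le> 1 \<longrightarrow>
      cmod (ovl dA dB (2^m) JA JB (rhoAB dC psi) - ovl dA dB (2^m) JA J (rhoAB dC psi)) \<le> e"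
proof -
  define A where "A = {coefB dA dB (2^m) JA (rhoAB dC psi) | JA psi. JA \<in> chans dA (2^m) \<and> sqnorm {..<dA * dB * dC} psi \<le> 1}"
  have b: "\<forall>a\<in>A. \<forall>i\<in>cidx dB (2^m). cmod (a i) \<le> (real dA)\<^sup>2"
  proof (intro ballI)
    fix a i assume "a \<in> A" "i \<in> cidx dB (2^m)"
    then obtain JA psi x y r r' where J: "a = coefB dA dB (2^m) JA (rhoAB dC psi)" "JA \<in> chans dA (2^m)"
        "sqnorm {..<dA * dB * dC} psi \<le> 1"
      and i: "i = (x, y, r, r')" "x < dB" "y < dB" "r < 2^m" "r' < 2^m"
      unfolding A_def cidx_def by blast
    show "cmod (a i) \<le> (real dA)\<^sup>2"
      unfolding J(1) i(1) coefB_def prod.case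
    proof (rule cmod_double_sum_le, rule cmod_coef_term_le)
      fix z w assume "z < dA" "w < dA"
      then show "cmod (JA (z, w, r, r')) \<le> 1" using i by (intro chans_entry_le[OF J(2)]) (simp add: cidx_def)
      show "cmod (rhoAB dC psi (z * dB + x) (w * dB + y)) \<le> 1"
        using i \<open>z < dA\<close> \<open>w < dA\<close> by (intro rhoAB_entry_le[OF J(3)] less_mult_divmod)
    qed simp
  qed
  have K: "chans dB (2^m) \<subseteq> body (cidx dB (2^m)) A 1"
  proof
    fix x assume x: "x \<in> chans dB (2^m)"
    have "cmod (ovl dA dB (2^m) JA x (rhoAB dC psi)) \<le> 1" if J: "JA \<in> chans dA (2^m)" and "sqnorm {..<dA * dB * dC} psi \<le> 1" for JA psi
      using cmod_ovl_le[OF J x assms(2), of dC psi] that(2) by (rule order_trans)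
    moreover have "x \<in> space (cprod (cidx dB (2^m)))" using x by (simp add: chans_def)
    ultimately show "x \<in> body (cidx dB (2^m)) A 1"
      using chans_entry_le[OF x] unfolding body_def A_def ovl_linB by blast
  qed
  obtain N where N: "finite N" "N \<subseteq> chans dB (2^m)" "real (card N) \<le> (1 + 2 / e) ^ (2 * card (cidx dB (2^m)))"
    "\<And>x. x \<in> chans dB (2^m) \<Longrightarrow> \<exists>y\<in>N. \<forall>a\<in>A. cmod (lin (cidx dB (2^m)) a x - lin (cidx dB (2^m)) a y) \<le> e"
    using covering_number[OF finite_cidx b e K] by blast
  show thesis
  proof (rule that[OF N(1,2)])
    show "real (card N) \<le> (1 + 2 / e) ^ (2 * (dB\<^sup>2 * (2^m)\<^sup>2))" using N(3) by (simp add: card_cidx)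
    fix JB assume "JB \<in> chans dB (2^m)"
    from N(4)[OF this] obtain J where J: "J \<in> N"
      "\<forall>a\<in>A. cmod (lin (cidx dB (2^m)) a JB - lin (cidx dB (2^m)) a J) \<le> e" by blast
    then show "\<exists>J\<in>N. \<forall>JA\<in>chans dA (2^m). \<forall>psi. sqnorm {..<dA * dB * dC} psi \<le> 1 \<longrightarrow>
      cmod (ovl dA dB (2^m) JA JB (rhoAB dC psi) - ovl dA dB (2^m) JA J (rhoAB dC psi)) \<le> e"
      unfolding ovl_linB A_def by blast
  qed
qed

section \<open>The overlap as a quadratic form in the state vector\<close>

definition omat :: "nat \<Rightarrow> nat \<Rightarrow> choi \<Rightarrow> choi \<Rightarrow> cmat" where
  "omat dB M JA JB = (\<lambda>x y. (\<Sum>r<M. \<Sum>r'<M. JA (x div dB, y div dB, r, r') * JB (x mod dB, y mod dB, r, r')) / of_nat M)"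

text \<open>The transpose of \<open>omat\<close> tensored with the identity on C. The transposition
  arises because the second index of \<open>rhoAB\<close> carries the conjugated vector, whereas
  \<open>qform\<close> conjugates at the first.\<close>

definition wmat :: "nat \<Rightarrow> nat \<Rightarrow> nat \<Rightarrow> choi \<Rightarrow> choi \<Rightarrow> cmat" where
  "wmat dB dC M JA JB = (\<lambda>i j. if i mod dC = j mod dC then omat dB M JA JB (j div dC) (i div dC) else 0)"

lemma ovl_omat:
  "ovl dA dB M JA JB rho = (\<Sum>x<dA * dB. \<Sum>y<dA * dB. rho x y * omat dB M JA JB x y)"
proof -
  let ?t = "\<lambda>a a' b b'. rho (a * dB + b) (a' * dB + b') * omat dB M JA JB (a * dB + b) (a' * dB + b')"
  have "(\<Sum>x<dA * dB. \<Sum>y<dA * dB. rho x y * omat dB M JA JB x y)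
      = (\<Sum>a<dA. \<Sum>b<dB. \<Sum>a'<dA. \<Sum>b'<dB. ?t a a' b b')"
    unfolding sum_divmod ..
  also have "\<dots> = (\<Sum>a<dA. \<Sum>a'<dA. \<Sum>b<dB. \<Sum>b'<dB. ?t a a' b b')"
    by (rule sum.cong[OF refl], rule sum.swap)
  also have "\<dots> = (\<Sum>a<dA. \<Sum>a'<dA. \<Sum>b<dB. \<Sum>b'<dB. \<Sum>r<M. \<Sum>r'<M.
      rho (a * dB + b) (a' * dB + b') * JA (a, a', r, r') * JB (b, b', r, r') / of_nat M)"
    by (intro sum.cong refl) (simp add: omat_def sum_distrib_left sum_divide_distrib mult.assoc)
  also have "\<dots> = ovl dA dB M JA JB rho" by (simp only: ovl_def sum_divide_distrib)
  finally show ?thesis ..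
qed

lemma ovl_qform: "ovl dA dB M JA JB (rhoAB dC psi) = qform (dA * dB * dC) (wmat dB dC M JA JB) psi"
proof -
  define D where "D = dA * dB"
  let ?O = "omat dB M JA JB"
  have "qform (D * dC) (wmat dB dC M JA JB) psi = (\<Sum>y<D. \<Sum>c'<dC. \<Sum>x<D. \<Sum>c<dC.
      if c = c' then cnj (psi (y * dC + c')) * ?O x y * psi (x * dC + c') else 0)"
    unfolding qform_def sum_divmod by (intro sum.cong refl) (auto simp: wmat_def)
  also have "\<dots> = (\<Sum>y<D. \<Sum>c'<dC. \<Sum>x<D. cnj (psi (y * dC + c')) * ?O x y * psi (x * dC + c'))"
    by simp
  also have "\<dots> = (\<Sum>y<D. \<Sum>x<D. \<Sum>c'<dC. cnj (psi (y * dC + c')) * ?O x y * psi (x * dC + c'))"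
    by (rule sum.cong[OF refl], rule sum.swap)
  also have "\<dots> = (\<Sum>x<D. \<Sum>y<D. \<Sum>c'<dC. cnj (psi (y * dC + c')) * ?O x y * psi (x * dC + c'))"
    by (rule sum.swap)
  also have "\<dots> = (\<Sum>x<D. \<Sum>y<D. rhoAB dC psi x y * ?O x y)"
    unfolding rhoAB_def sum_distrib_right by (intro sum.cong refl) (simp add: mult_ac)
  finally show ?thesis unfolding ovl_omat D_def ..
qed

text \<open>The trace is \<open>dC / M\<close> times the entrywise pairing of the images
  \<open>S\<close> and \<open>T\<close> of the two identities, which \<open>psd_frobenius_le\<close>
  bounds by the product of their traces \<open>dA\<close> and \<open>dB\<close>.\<close>

lemma trace_wmat_le:
  assumes J: "JA \<in> chans dA M" "JB \<in> chans dB M" and "0 < M"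
  shows "Re (mtrace (dA * dB * dC) (wmat dB dC M JA JB)) \<le> 1 / M * real (dA * dB * dC)"
proof -
  define S where "S = (\<lambda>r r'. \<Sum>a<dA. chan_of dA JA (unitm a a) r r')"
  define T where "T = (\<lambda>r r'. \<Sum>b<dB. chan_of dB JB (unitm b b) r r')"
  have ch: "channel dA M (chan_of dA JA)" "channel dB M (chan_of dB JB)" using J by (auto simp: chans_def)
  have SJ: "S = (\<lambda>r r'. \<Sum>a<dA. JA (a, a, r, r'))" "T = (\<lambda>r r'. \<Sum>b<dB. JB (b, b, r, r'))"
    by (auto simp: S_def T_def chan_of_unitm fun_eq_iff)
  have "mtrace (dA * dB * dC) (wmat dB dC M JA JB) = of_nat dC * (\<Sum>x<dA * dB. omat dB M JA JB x x)"
    unfolding mtrace_def sum_divmod[of _ _ dC] by (simp add: wmat_def sum_distrib_left)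
  also have "(\<Sum>x<dA * dB. omat dB M JA JB x x)
      = (\<Sum>a<dA. \<Sum>b<dB. \<Sum>r<M. \<Sum>r'<M. JA (a, a, r, r') * JB (b, b, r, r')) / of_nat M"
    unfolding sum_divmod sum_divide_distrib by (intro sum.cong refl) (simp add: omat_def sum_divide_distrib)
  also have "(\<Sum>a<dA. \<Sum>b<dB. \<Sum>r<M. \<Sum>r'<M. JA (a, a, r, r') * JB (b, b, r, r')) = (\<Sum>r<M. \<Sum>r'<M. S r r' * T r r')"
    unfolding SJ sum_product by (rule sum_swap_pairs)
  finally have tr: "Re (mtrace (dA * dB * dC) (wmat dB dC M JA JB)) = dC * (Re (\<Sum>r<M. \<Sum>r'<M. S r r' * T r r') / M)"
    by (simp add: Re_divide_nat)
  have "Re (\<Sum>r<M. \<Sum>r'<M. S r r' * T r r') \<le> cmod (\<Sum>r<M. \<Sum>r'<M. S r r' * T r r')"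
    by (rule complex_Re_le_cmod)
  also have "\<dots> \<le> Re (mtrace M S) * Re (mtrace M T)"
    unfolding S_def T_def by (intro psd_frobenius_le channel_id ch)
  also have "\<dots> = real dA * real dB"
    unfolding S_def T_def by (simp only: channel_id(2)[OF ch(1)] channel_id(2)[OF ch(2)])
  finally have "dC * (Re (\<Sum>r<M. \<Sum>r'<M. S r r' * T r r') / M) \<le> dC * (real dA * real dB / M)"
    by (intro mult_left_mono divide_right_mono) auto
  then show ?thesis unfolding tr by (simp add: mult_ac)
qed

section \<open>The probability bound\<close>

lemma sqnorm_normalize:
  assumes "0 < vnorm d v"
  shows "sqnorm {..<d} (\<lambda>i. v i / of_real (vnorm d v)) = 1"
proof -
  have "sqnorm {..<d} (\<lambda>i. v i / of_real (vnorm d v)) = sqnorm {..<d} v / (vnorm d v)\<^sup>2"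
    by (simp add: sqnorm_def norm_divide power_divide sum_divide_distrib)
  also have "(vnorm d v)\<^sup>2 = sqnorm {..<d} v" by (simp add: vnorm_sqnorm sqnorm_nonneg)
  finally show ?thesis using assms by (simp add: vnorm_sqnorm)
qed

lemma qform_normalize:
  assumes "0 < vnorm d v"
  shows "qform d W v = of_real (sqnorm {..<d} v) * qform d W (\<lambda>i. v i / of_real (vnorm d v))"
proof -
  have "qform d W (\<lambda>i. v i / of_real (vnorm d v)) = qform d W v / of_real ((vnorm d v)\<^sup>2)"
    unfolding qform_def sum_divide_distrib by (intro sum.cong refl) (simp add: power2_eq_square)
  moreover have "(vnorm d v)\<^sup>2 = sqnorm {..<d} v" by (simp add: vnorm_sqnorm sqnorm_nonneg)
  moreover have "sqnorm {..<d} v \<noteq> 0" using assms by (auto simp: vnorm_sqnorm)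
  ultimately show ?thesis by simp
qed

lemma sets_haar_event:
  assumes "closed {psi. P psi}"
  shows "haar_event d P \<in> sets (cvec_space d)"
proof -
  have [measurable]: "(\<lambda>v. vnorm d v) \<in> borel_measurable (cprod {..<d})"
    unfolding vnorm_sqnorm by (rule measurable_compose[OF measurable_sqnorm borel_measurable_sqrt])
  define f where "f = (\<lambda>v i. v i / of_real (vnorm d v))"
  have "f \<in> borel_measurable (cprod {..<d})"
    unfolding f_def
    by (intro measurable_coordinatewise_then_product borel_measurable_divide borel_measurable_coord borel_measurable_of_real) measurable
  then have "f -` {psi. P psi} \<inter> space (cprod {..<d}) \<in> sets (cprod {..<d})"
    using assms by (intro measurable_sets) auto
  moreover have "{v \<in> space (cprod {..<d}). 0 < vnorm d v} \<in> sets (cprod {..<d})"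
    "{v \<in> space (cprod {..<d}). vnorm d v \<le> 1} \<in> sets (cprod {..<d})"
    by measurable
  ultimately have "(f -` {psi. P psi} \<inter> space (cprod {..<d})) \<inter> {v \<in> space (cprod {..<d}). 0 < vnorm d v}
      \<inter> {v \<in> space (cprod {..<d}). vnorm d v \<le> 1} \<in> sets (cprod {..<d})" by blast
  also have "\<dots> = sets (cvec_space d)" by (simp add: cvec_space_def)
  also have "(f -` {psi. P psi} \<inter> space (cprod {..<d})) \<inter> {v \<in> space (cprod {..<d}). 0 < vnorm d v}
      \<inter> {v \<in> space (cprod {..<d}). vnorm d v \<le> 1} = haar_event d P"
    by (auto simp: haar_event_def cvec_space_def f_def)
  finally show ?thesis .
qed

lemma measure_unit_ball_pos: "0 < measure (cprod {..<d::nat}) {v \<in> space (cprod {..<d}). sqnorm {..<d} v \<le> 1}"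
  using emeasure_unit_ball[of "{..<d}"] by (simp add: measure_def enn2real_positive_iff)

text \<open>Union bound over pairs from the two nets, each pair contributing one cone. The base is
  \<open>1 + 2/e\<close> at accuracy \<open>e = \<delta>/16\<close>.\<close>

lemma haar_prob_le_net:
  fixes dA dB dC m :: nat and h :: real
  assumes h: "h \<le> 1" "0 < h" and delta: "0 < h\<^sup>2 - 1 / 2 ^ m" and dB: "1 \<le> dB"
  defines "\<delta> \<equiv> h\<^sup>2 - 1 / 2 ^ m" and "d \<equiv> dA * dB * dC"
  shows "haar_prob d (\<lambda>psi. lo_achievable dA dB (rhoAB dC psi) h m)
    \<le> (1 + 32 / \<delta>) ^ (2 * (2^m)\<^sup>2 * (dA\<^sup>2 + dB\<^sup>2)) * exp (- 2 * real d * (7 / 8 * \<delta>)\<^sup>2)"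
proof -
  let ?M = "cprod {..<d}"
  let ?P = "\<lambda>psi. lo_achievable dA dB (rhoAB dC psi) h m"
  let ?B = "{v \<in> space ?M. sqnorm {..<d} v \<le> 1}"
  let ?F = "\<lambda>JA JB psi. ovl dA dB (2^m) JA JB (rhoAB dC psi)"
  \<comment> \<open>Two replacements at accuracy \<open>\<delta>/16\<close> lower the threshold by
    \<open>\<delta>/8\<close>.\<close>
  define t where "t = h\<^sup>2 - \<delta> / 8"
  have d0: "0 < \<delta>" using delta by (simp add: \<delta>_def)
  have "h\<^sup>2 = \<delta> + 1 / 2 ^ m" by (simp add: \<delta>_def)
  then have tp: "t - 1 / 2 ^ m = 7 / 8 * \<delta>" by (simp add: t_def)
  have e: "0 < \<delta> / 16" using d0 by simp
  obtain NA where NA: "finite NA" "NA \<subseteq> chans dA (2^m)" "real (card NA) \<le> (1 + 2 / (\<delta> / 16)) ^ (2 * (dA\<^sup>2 * (2^m)\<^sup>2))"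
    "\<And>JA. JA \<in> chans dA (2^m) \<Longrightarrow> \<exists>J\<in>NA. \<forall>JB\<in>chans dB (2^m). \<forall>psi. sqnorm {..<d} psi \<le> 1 \<longrightarrow>
      cmod (?F JA JB psi - ?F J JB psi) \<le> \<delta> / 16"
    unfolding d_def using netA[OF e dB, where dA = dA and m = m and dC = dC] by blast
  obtain NB where NB: "finite NB" "NB \<subseteq> chans dB (2^m)" "real (card NB) \<le> (1 + 2 / (\<delta> / 16)) ^ (2 * (dB\<^sup>2 * (2^m)\<^sup>2))"
    "\<And>JB. JB \<in> chans dB (2^m) \<Longrightarrow> \<exists>J\<in>NB. \<forall>JA\<in>chans dA (2^m). \<forall>psi. sqnorm {..<d} psi \<le> 1 \<longrightarrow>
      cmod (?F JA JB psi - ?F JA J psi) \<le> \<delta> / 16"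
    unfolding d_def using netB[OF e dB, where dA = dA and m = m and dC = dC] by blast
  define W where "W = (\<lambda>(JA, JB). wmat dB dC (2^m) JA JB)"
  define C where "C = (\<lambda>x. {v \<in> space ?M. sqnorm {..<d} v \<le> 1 \<and> t * sqnorm {..<d} v \<le> Re (qform d (W x) v)})"
  have F: "?F JA JB psi = qform d (W (JA, JB)) psi" for JA JB psi
    by (simp add: W_def d_def ovl_qform)
  have sub: "haar_event d ?P \<subseteq> (\<Union>x\<in>NA \<times> NB. C x)"
  proof
    fix v assume "v \<in> haar_event d ?P"
    then have v: "v \<in> space ?M" "0 < vnorm d v" "vnorm d v \<le> 1"
      and P: "?P (\<lambda>i. v i / of_real (vnorm d v))"
      by (auto simp: haar_event_def cvec_space_def)
    define psi where "psi = (\<lambda>i. v i / of_real (vnorm d v))"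
    have psi: "sqnorm {..<d} psi \<le> 1" unfolding psi_def using sqnorm_normalize[OF v(2)] by simp
    from P obtain JA JB where J: "JA \<in> chans dA (2^m)" "JB \<in> chans dB (2^m)" "h\<^sup>2 \<le> Re (?F JA JB psi)"
      unfolding lo_achievable_iff psi_def by blast
    obtain JA' where A: "JA' \<in> NA" "cmod (?F JA JB psi - ?F JA' JB psi) \<le> \<delta> / 16"
      using NA(4)[OF J(1)] J(2) psi by blast
    obtain JB' where B: "JB' \<in> NB" "cmod (?F JA' JB psi - ?F JA' JB' psi) \<le> \<delta> / 16"
      using NB(4)[OF J(2)] A(1) NA(2) psi by blast
    have "Re (?F JA JB psi) - Re (?F JA' JB psi) \<le> \<delta> / 16" "Re (?F JA' JB psi) - Re (?F JA' JB' psi) \<le> \<delta> / 16"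
      using complex_Re_le_cmod[of "?F JA JB psi - ?F JA' JB psi"] A(2)
        complex_Re_le_cmod[of "?F JA' JB psi - ?F JA' JB' psi"] B(2) by auto
    then have "t \<le> Re (qform d (W (JA', JB')) psi)" using J(3) unfolding F t_def by linarith
    \<comment> \<open>Homogeneity turns the bound at the normalised vector into the cone condition
      at \<open>v\<close>.\<close>
    then have "sqnorm {..<d} v * t \<le> sqnorm {..<d} v * Re (qform d (W (JA', JB')) psi)"
      by (intro mult_left_mono sqnorm_nonneg)
    also have "\<dots> = Re (qform d (W (JA', JB')) v)"
      unfolding qform_normalize[OF v(2), of "W (JA', JB')"] psi_def by simp
    finally have "v \<in> C (JA', JB')" using v by (simp add: C_def vnorm_sqnorm mult.commute)
    then show "v \<in> (\<Union>x\<in>NA \<times> NB. C x)" using A(1) B(1) by blast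
  qed
  have Csets: "C x \<in> sets ?M" for x
  proof -
    have "{v \<in> space ?M. t * sqnorm {..<d} v \<le> Re (qform d (W x) v)} \<in> sets ?M"
      by (intro borel_measurable_le borel_measurable_times borel_measurable_const measurable_sqnorm
        measurable_compose[OF measurable_qform borel_measurable_Re])
    then show ?thesis unfolding C_def by (intro sets.sets_Collect_conj measurable_unit_ball)
  qed
  have fin: "emeasure ?M ?B < \<infinity>" by (rule emeasure_unit_ball) simp
  then have fmB: "?B \<in> fmeasurable ?M" using measurable_unit_ball[of "{..<d}"] by (simp add: fmeasurable_def)
  have fmC: "C x \<in> fmeasurable ?M" for x
    by (rule fmeasurableI2[OF fmB _ Csets]) (auto simp: C_def)
  have Cle: "measure ?M (C x) \<le> exp (- 2 * real d * (7 / 8 * \<delta>)\<^sup>2) * measure ?M ?B" if xN: "x \<in> NA \<times> NB" for x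
  proof -
    obtain JA JB where x: "x = (JA, JB)" "JA \<in> chans dA (2^m)" "JB \<in> chans dB (2^m)"
      using xN NA(2) NB(2) by auto
    have "Im (qform d (W x) v) = 0 \<and> 0 \<le> Re (qform d (W x) v) \<and> Re (qform d (W x) v) \<le> sqnorm {..<d} v" for v
      unfolding x(1) F[symmetric] unfolding d_def using ovl_bounds[OF x(2,3) dB, of dC v] by blast
    moreover have "Re (mtrace d (W x)) \<le> 1 / 2 ^ m * real d"
      using trace_wmat_le[OF x(2,3), of dC] by (simp add: W_def x(1) d_def)
    moreover have "(0::real) < 1 / 2 ^ m" by simp
    moreover have "1 / 2 ^ m < t" using tp d0 by linarith
    moreover have "t < 1" using d0 power_le_one[of h 2] h by (simp add: t_def)
    ultimately have "measure ?M (C x) \<le> exp (- 2 * real d * (t - 1 / 2 ^ m)\<^sup>2) * measure ?M ?B"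
      unfolding C_def by (rule measure_cone_le)
    then show ?thesis unfolding tp .
  qed
  have "measure ?M (haar_event d ?P) \<le> measure ?M (\<Union>x\<in>NA \<times> NB. C x)"
    using sub sets_haar_event[OF closed_achievable[of dA dB dC h m], of d] NA(1) NB(1) fmC
    by (intro measure_mono_fmeasurable fmeasurable.finite_UN) (auto simp: cvec_space_def)
  also have "\<dots> \<le> (\<Sum>x\<in>NA \<times> NB. measure ?M (C x))"
    using NA(1) NB(1) fmC by (intro measure_UNION_le) auto
  also have "\<dots> \<le> (\<Sum>x\<in>NA \<times> NB. exp (- 2 * real d * (7 / 8 * \<delta>)\<^sup>2) * measure ?M ?B)"
    using Cle by (rule sum_mono)
  also have "\<dots> = (real (card NA) * real (card NB)) * (exp (- 2 * real d * (7 / 8 * \<delta>)\<^sup>2) * measure ?M ?B)"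
    by (simp add: card_cartesian_product)
  also have "\<dots> \<le> (1 + 32 / \<delta>) ^ (2 * (2^m)\<^sup>2 * (dA\<^sup>2 + dB\<^sup>2)) * (exp (- 2 * real d * (7 / 8 * \<delta>)\<^sup>2) * measure ?M ?B)"
  proof (rule mult_right_mono)
    have "real (card NA) * real (card NB) \<le> (1 + 32 / \<delta>) ^ (2 * (dA\<^sup>2 * (2^m)\<^sup>2)) * (1 + 32 / \<delta>) ^ (2 * (dB\<^sup>2 * (2^m)\<^sup>2))"
      using NA(3) NB(3) d0 by (intro mult_mono) auto
    also have "\<dots> = (1 + 32 / \<delta>) ^ (2 * (2^m)\<^sup>2 * (dA\<^sup>2 + dB\<^sup>2))"
      unfolding power_add[symmetric] by (rule arg_cong[where f = "power _"]) (simp add: algebra_simps)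
    finally show "real (card NA) * real (card NB) \<le> (1 + 32 / \<delta>) ^ (2 * (2^m)\<^sup>2 * (dA\<^sup>2 + dB\<^sup>2))" .
  qed simp
  finally have "measure ?M (haar_event d ?P) / measure ?M ?B
      \<le> (1 + 32 / \<delta>) ^ (2 * (2^m)\<^sup>2 * (dA\<^sup>2 + dB\<^sup>2)) * exp (- 2 * real d * (7 / 8 * \<delta>)\<^sup>2)"
    using measure_unit_ball_pos[of d] by (simp add: pos_divide_le_eq mult.assoc)
  moreover have "{v \<in> space ?M. vnorm d v \<le> 1} = ?B" by (simp add: vnorm_sqnorm)
  ultimately show ?thesis by (simp add: haar_prob_def cvec_space_def)
qed

lemma haar_prob_mono:
  assumes "\<And>psi. P psi \<Longrightarrow> P' psi" and P: "haar_event d P \<in> sets (cvec_space d)" and P': "haar_event d P' \<in> sets (cvec_space d)"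
  shows "haar_prob d P \<le> haar_prob d P'"
proof -
  let ?M = "cprod {..<d}"
  let ?B = "{v \<in> space ?M. sqnorm {..<d} v \<le> 1}"
  have "emeasure ?M ?B < \<infinity>" by (rule emeasure_unit_ball) simp
  then have "?B \<in> fmeasurable ?M" using measurable_unit_ball[of "{..<d}"] by (simp add: fmeasurable_def)
  then have "haar_event d P' \<in> fmeasurable ?M"
    by (rule fmeasurableI2) (use P' in \<open>auto simp: haar_event_def cvec_space_def vnorm_sqnorm\<close>)
  moreover have "haar_event d P \<subseteq> haar_event d P'" using assms(1) by (auto simp: haar_event_def)
  ultimately have "measure (cvec_space d) (haar_event d P) \<le> measure (cvec_space d) (haar_event d P')"
    using P unfolding cvec_space_def by (intro measure_mono_fmeasurable)
  then show ?thesis unfolding haar_prob_def by (intro divide_right_mono) auto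
qed

text \<open>As \<open>1/\<delta> \<ge> 2\<close>, one has
  \<open>1 + 32/\<delta> \<le> 64/\<delta> \<le> (1/\<delta>)^7\<close>, so 14 would do in place of
  3584; the larger constant is the one shared with the other case.\<close>

lemma net_exponent_small:
  fixes \<delta> :: real and M n :: nat
  assumes "0 < \<delta>" "\<delta> < 1/2"
  shows "(1 + 32 / \<delta>) ^ (2 * M\<^sup>2 * n) \<le> exp (3584 * (real M)\<^sup>2 * real n * ln (1 / \<delta>))"
proof -
  have "2 \<le> 1 / \<delta>" using assms by (simp add: field_simps)
  then have "2 ^ 6 \<le> (1 / \<delta>) ^ 6" by (intro power_mono) auto
  then have "64 * (1 / \<delta>) \<le> (1 / \<delta>) ^ 6 * (1 / \<delta>)" using assms by (intro mult_right_mono) auto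
  moreover have "1 + 32 / \<delta> \<le> 64 * (1 / \<delta>)" using assms by (simp add: field_simps)
  moreover have "x ^ 6 * x = x ^ 7" for x :: real by (simp add: eval_nat_numeral)
  ultimately have "1 + 32 / \<delta> \<le> (1 / \<delta>) ^ 7" by (metis order_trans)
  also have "\<dots> = exp (7 * ln (1 / \<delta>))"
    using assms by (metis exp_ln exp_of_nat_mult of_nat_numeral zero_less_divide_1_iff)
  finally have "(1 + 32 / \<delta>) ^ (2 * M\<^sup>2 * n) \<le> exp (7 * ln (1 / \<delta>)) ^ (2 * M\<^sup>2 * n)"
    using assms by (intro power_mono) auto
  also have "\<dots> = exp (14 * ((real M)\<^sup>2 * real n * ln (1 / \<delta>)))"
    by (simp add: exp_of_nat_mult[symmetric] mult_ac)
  also have "\<dots> \<le> exp (3584 * ((real M)\<^sup>2 * real n * ln (1 / \<delta>)))"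
  proof -
    have "0 \<le> (real M)\<^sup>2 * real n * ln (1 / \<delta>)"
      using assms by (intro mult_nonneg_nonneg) auto
    then show ?thesis unfolding exp_le_cancel_iff by linarith
  qed
  finally show ?thesis by (simp add: mult.assoc)
qed

text \<open>The base is at most 128 = 2^7, hence at most \<open>exp 7\<close>. From
  \<open>ln (1/\<delta>) \<ge> 1 - \<delta> \<ge> 1/M\<close> follows
  \<open>M^2 ln (1/\<delta>) \<ge> M \<ge> 1\<close>, enough to pay for a net whose size is bounded
  through \<open>M1 \<le> 16\<close>.\<close>

lemma net_exponent_large:
  fixes \<delta> \<delta>1 :: real and M M1 n :: nat
  assumes "7/16 \<le> \<delta>1" "0 < \<delta>" "\<delta> \<le> 1 - 1 / real M" "1 \<le> M" "M1 \<le> 16"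
  shows "(1 + 32 / \<delta>1) ^ (2 * M1\<^sup>2 * n) \<le> exp (3584 * (real M)\<^sup>2 * real n * ln (1 / \<delta>))"
proof -
  have "1 + 32 / \<delta>1 \<le> 128" using assms by (simp add: field_simps)
  also have "(128::real) = 2 ^ 7" by simp
  also have "\<dots> \<le> exp 1 ^ 7" using exp_ge_add_one_self[of 1] by (intro power_mono) auto
  also have "\<dots> = exp 7" by (simp flip: exp_of_nat_mult)
  finally have "(1 + 32 / \<delta>1) ^ (2 * M1\<^sup>2 * n) \<le> exp 7 ^ (2 * M1\<^sup>2 * n)"
    using assms by (intro power_mono) auto
  also have "\<dots> = exp (14 * (real M1)\<^sup>2 * real n)"
    by (simp add: exp_of_nat_mult[symmetric] mult_ac)
  also have "\<dots> \<le> exp (3584 * ((real M)\<^sup>2 * ln (1 / \<delta>)) * real n)"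
  proof -
    have "(real M1)\<^sup>2 \<le> 16\<^sup>2" using assms by (intro power_mono) auto
    then have "(real M1)\<^sup>2 \<le> 256" by simp
    moreover have "1 \<le> (real M)\<^sup>2 * ln (1 / \<delta>)"
    proof -
      have "1 / real M \<le> ln (1 / \<delta>)"
        using ln_le_minus_one[of \<delta>] assms by (simp add: ln_div)
      then have "(real M)\<^sup>2 * (1 / real M) \<le> (real M)\<^sup>2 * ln (1 / \<delta>)" by (intro mult_left_mono) auto
      moreover have "(real M)\<^sup>2 * (1 / real M) = real M" using assms by (simp add: power2_eq_square)
      ultimately show ?thesis using assms by simp
    qed
    ultimately have "14 * (real M1)\<^sup>2 \<le> 3584 * ((real M)\<^sup>2 * ln (1 / \<delta>))" by linarith
    then show ?thesis by (simp add: mult_right_mono)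
  qed
  finally show ?thesis by (simp add: mult_ac)
qed

lemma haar_prob_ED_LO_le:
  fixes dA dB dC m :: nat and h c :: real
  assumes h: "0 < h" "h \<le> 1" and delta: "0 < h\<^sup>2 - 1 / 2 ^ m" and dB: "1 \<le> dB" and c: "c \<le> 1"
  defines "\<delta> \<equiv> h\<^sup>2 - 1 / 2 ^ m" and "d \<equiv> dA * dB * dC"
    and "P \<equiv> \<lambda>psi. enat m \<le> ED_LO dA dB (rhoAB dC psi) h"
  shows "haar_event d P \<in> sets (cvec_space d)"
    and "haar_prob d P \<le> exp (- c * \<delta>\<^sup>2 * real d + 3584 * 2 ^ (2 * m) * ((real dA)\<^sup>2 + (real dB)\<^sup>2) * ln (1 / \<delta>))"
proof -
  have d0: "0 < \<delta>" using delta by (simp add: \<delta>_def)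
  have h2: "h\<^sup>2 \<le> 1" using h by (simp add: power_le_one)
  \<comment> \<open>At \<open>m = 0\<close> positivity of \<open>\<delta>\<close> would require
    \<open>h^2 > 1\<close>.\<close>
  have "0 < m" using d0 h2 by (cases m) (auto simp: \<delta>_def)
  then have P: "P psi \<longleftrightarrow> lo_achievable dA dB (rhoAB dC psi) h m" for psi
    unfolding P_def by (intro le_ED_LO_iff psd_rhoAB dB)
  show ev: "haar_event d P \<in> sets (cvec_space d)"
    using closed_achievable[of dA dB dC h m] by (intro sets_haar_event) (simp add: P)
  define m1 where "m1 = (if \<delta> < 1/2 then m else min m 4)"
  define \<delta>1 where "\<delta>1 = h\<^sup>2 - 1 / 2 ^ m1"
  define n where "n = dA\<^sup>2 + dB\<^sup>2"
  have \<delta>M: "\<delta> \<le> 1 - 1 / real (2 ^ m)" using h2 by (simp add: \<delta>_def)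
  \<comment> \<open>The factor 2 from the concentration exponent absorbs the net loss
    \<open>(7/8)^2\<close> and, for large \<open>\<delta>\<close>, the further
    \<open>(7/8)^2\<close> from truncation.\<close>
  have key: "0 < \<delta>1 \<and> \<delta>\<^sup>2 \<le> 2 * (7 / 8 * \<delta>1)\<^sup>2 \<and>
      (1 + 32 / \<delta>1) ^ (2 * (2 ^ m1)\<^sup>2 * n) \<le> exp (3584 * (real (2 ^ m))\<^sup>2 * real n * ln (1 / \<delta>))"
  proof (cases "\<delta> < 1/2")
    case True
    then have "\<delta>1 = \<delta>" "m1 = m" by (auto simp: \<delta>1_def \<delta>_def m1_def)
    then show ?thesis using d0 net_exponent_small[OF d0 True, of "2 ^ m" n] by (simp add: power_mult_distrib power_divide)
  next
    case False
    \<comment> \<open>Truncating to four pairs leaves at least \<open>\<delta> - 1/16\<close>, and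
      \<open>1/16 \<le> \<delta>/8\<close> because \<open>\<delta> \<ge> 1/2\<close>.\<close>
    have \<delta>1: "7/8 * \<delta> \<le> \<delta>1"
    proof (cases "m \<le> 4")
      case True
      then have "\<delta>1 = \<delta>" using False by (simp add: \<delta>1_def \<delta>_def m1_def)
      then show ?thesis using d0 by simp
    next
      case 4: False
      then have "\<delta>1 = h\<^sup>2 - 1/16" using False by (simp add: \<delta>1_def m1_def min_def)
      moreover have "\<delta> \<le> h\<^sup>2" by (simp add: \<delta>_def)
      ultimately show ?thesis using False by simp
    qed
    then have "7/16 \<le> \<delta>1" using False by simp
    moreover have "2 ^ m1 \<le> (2::nat) ^ 4" using False by (intro power_increasing) (auto simp: m1_def)
    ultimately have "(1 + 32 / \<delta>1) ^ (2 * (2 ^ m1)\<^sup>2 * n) \<le> exp (3584 * (real (2 ^ m))\<^sup>2 * real n * ln (1 / \<delta>))"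
      using \<delta>M d0 by (intro net_exponent_large) auto
    moreover have "(7/8 * \<delta>)\<^sup>2 \<le> \<delta>1\<^sup>2" using \<delta>1 d0 by (intro power_mono) auto
    then have "49 / 64 * \<delta>\<^sup>2 \<le> \<delta>1\<^sup>2" by (simp add: power_mult_distrib power_divide)
    then have "\<delta>\<^sup>2 \<le> 2 * (49 / 64 * \<delta>1\<^sup>2)" using zero_le_power2[of \<delta>1] by linarith
    then have "\<delta>\<^sup>2 \<le> 2 * (7 / 8 * \<delta>1)\<^sup>2" by (simp add: power_mult_distrib power_divide)
    ultimately show ?thesis using \<open>7/16 \<le> \<delta>1\<close> by simp
  qed
  let ?P1 = "\<lambda>psi. lo_achievable dA dB (rhoAB dC psi) h m1"
  have "haar_prob d P \<le> haar_prob d ?P1"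
  proof (rule haar_prob_mono[OF _ ev])
    show "?P1 psi" if "P psi" for psi
      using that unfolding P by (rule lo_achievable_mono) (use dB in \<open>auto simp: m1_def psd_rhoAB\<close>)
    show "haar_event d ?P1 \<in> sets (cvec_space d)"
      using closed_achievable by (rule sets_haar_event)
  qed
  also have "\<dots> \<le> (1 + 32 / \<delta>1) ^ (2 * (2 ^ m1)\<^sup>2 * n) * exp (- 2 * real d * (7 / 8 * \<delta>1)\<^sup>2)"
    unfolding \<delta>1_def n_def d_def using key h dB by (intro haar_prob_le_net) (auto simp: \<delta>1_def)
  also have "\<dots> \<le> exp (3584 * (real (2 ^ m))\<^sup>2 * real n * ln (1 / \<delta>)) * exp (- c * \<delta>\<^sup>2 * real d)"
  proof (rule mult_mono)
    have "c * \<delta>\<^sup>2 \<le> \<delta>\<^sup>2" using mult_right_mono[OF c, of "\<delta>\<^sup>2"] by simp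
    also have "\<dots> \<le> 2 * (7 / 8 * \<delta>1)\<^sup>2" using key by simp
    finally have "c * \<delta>\<^sup>2 * real d \<le> 2 * (7 / 8 * \<delta>1)\<^sup>2 * real d" by (intro mult_right_mono) auto
    then show "exp (- 2 * real d * (7 / 8 * \<delta>1)\<^sup>2) \<le> exp (- c * \<delta>\<^sup>2 * real d)" by (simp add: mult_ac)
  qed (use key in auto)
  also have "\<dots> = exp (- c * \<delta>\<^sup>2 * real d + 3584 * 2 ^ (2 * m) * ((real dA)\<^sup>2 + (real dB)\<^sup>2) * ln (1 / \<delta>))"
    unfolding n_def exp_add[symmetric] by (simp add: power_mult[symmetric] mult.commute[of m] add.commute)
  finally show "haar_prob d P \<le> exp (- c * \<delta>\<^sup>2 * real d + 3584 * 2 ^ (2 * m) * ((real dA)\<^sup>2 + (real dB)\<^sup>2) * ln (1 / \<delta>))" .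
qed

text \<open>The bound is exponentiated so that probability 0 needs no convention for its logarithm.
  The measurability clause makes \<open>haar_prob\<close> the probability of a genuine
  event.\<close>

theorem theorem2:
  fixes c :: real
  assumes "0 < c" and "c < 1"
  shows "\<exists>K::real. \<forall>(nA::nat) (nB::nat) (nC::nat) (m::nat) (h::real).
    0 < nA \<longrightarrow> 0 < nB \<longrightarrow> 0 < nC \<longrightarrow> 0 < h \<longrightarrow> h \<le> 1 \<longrightarrow>
    0 < h^2 - 1 / 2^m \<longrightarrow>
    (let d = (2::nat) ^ (nA + nB + nC); dA = (2::nat) ^ nA; dB = (2::nat) ^ nB;
         dC = (2::nat) ^ nC; \<delta> = h^2 - 1 / 2^m;
         P = (\<lambda>psi. enat m \<le> ED_LO dA dB (rhoAB dC psi) h)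
     in haar_event d P \<in> sets (cvec_space d) \<and>
        haar_prob d P \<le> exp (- c * \<delta>^2 * real d
           + K * 2^(2*m) * (real dA ^ 2 + real dB ^ 2) * ln (1 / \<delta>)))"
proof (intro exI[of _ 3584] allI impI)
  fix nA nB nC m :: nat and h :: real
  assume a: "0 < h" "h \<le> 1" "0 < h^2 - 1 / 2^m"
  have d: "(2::nat) ^ (nA + nB + nC) = 2 ^ nA * 2 ^ nB * 2 ^ nC" by (simp add: power_add)
  have B: "1 \<le> (2::nat) ^ nB" and c: "c \<le> 1" using assms by auto
  show "let d = (2::nat) ^ (nA + nB + nC); dA = (2::nat) ^ nA; dB = (2::nat) ^ nB;
         dC = (2::nat) ^ nC; \<delta> = h^2 - 1 / 2^m;
         P = (\<lambda>psi. enat m \<le> ED_LO dA dB (rhoAB dC psi) h)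
     in haar_event d P \<in> sets (cvec_space d) \<and>
        haar_prob d P \<le> exp (- c * \<delta>^2 * real d
           + 3584 * 2^(2*m) * (real dA ^ 2 + real dB ^ 2) * ln (1 / \<delta>))"
    unfolding Let_def d using haar_prob_ED_LO_le[OF a B c] by blast
qed

end
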